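(* Let $I$ be a non-empty compact subset of $\mathbb{R}^d$ which is the closure of its interior. Suppose given: (i) a countable (possibly finite) cover $\{I_\alpha\}_{\alpha\in\mathcal{A}}$ of $I$ by compact subsets of $I$, each the closure of its interior, such that $I_\alpha\cap I_\beta$ has Lebesgue measure zero for all $\alpha\ne\beta$; (ii) a family of maps $T_\alpha: I_\alpha\to I$, $\alpha\in\mathcal{A}$, such that each $T_\alpha: I_\alpha\to T_\alpha(I_\alpha)\subset I$ is a diffeomorphism, $\bigcup_{\alpha\in\mathcal{A}}T_\alpha(I_\alpha)=I$, and the Jacobian matrices are uniformly expanding: there is a constant $C>1$ such that $\|T'_\alpha(x)v\|\ge C\|v\|$ for all $\alpha\in\mathcal{A}$, $x\in I_\alpha$, $v\in\mathbb{R}^d$; (iii) continuous maps $S_\alpha: I_\alpha\times\mathbb{R}^d\to\mathbb{R}^d$, $\alpha\in\mathcal{A}$, of the form $S_\alpha(x,y)=(T'_\alpha(x)^{*})^{-1}y+f_\alpha(x)$, where $\{f_\alpha\}_{\alpha\in\mathcal{A}}$ is a family of piecewise continuous and uniformly bounded maps $f_\alpha:I_\alpha\to\mathbb{R}^d$ and $*$ denotes transpose. Put $\widetilde T_\alpha(x,y)=(T_\alpha(x),S_\alpha(x,y))$ for $(x,y)\in I_\alpha\times\mathbb{R}^d$. For $K$ a compact subset of $I\times\mathbb{R}^d$ projecting onto $I$, put $K_\alpha=\{(x,y)\in K\mid x\in I_\alpha\}$, $\widetilde T(K)=\bigcup_{\alpha\in\mathcal{A}}\widetilde T_\alpha(K_\alpha)$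 and $\Theta(K)=\overline{\widetilde T(K)}$. Let $K$ be the unique fixed point of $\Theta$ among compact subsets of $I\times\mathbb{R}^d$ projecting onto $I$. Let $m$ be Lebesgue measure on $\mathbb{R}^{2d}$ (restricted to $K$), let $\pi:K\to I$ be the projection $(x,y)\mapsto x$, and let $\mu=\pi_*(m|_K)$ be the marginal measure on $I$. Let $\mathcal{B}$ and $\widetilde{\mathcal{B}}$ be the Borel $\sigma$-algebras of $I$ and $K$. If $m(K)\neq 0$ and $m(K\setminus\widetilde T(K))=0$, then $(K,\widetilde{\mathcal{B}},m,\widetilde T)$ is a model for the natural extension of $(I,\mathcal{B},\mu,T)$.
   Context: $\|\cdot\|$ is the Euclidean norm. The map $T:I\to I$ is defined by $T(x)=T_\alpha(x)$ for $x\in I_\alpha$, and $\widetilde T$ on $K$ is defined by $\widetilde T(x,y)=\widetilde T_\alpha(x,y)$ for $x\in I_\alpha$; these may be multiply defined over the overlaps $I_\alpha\cap I_\beta$ ($\alpha\neq\beta$), which have measure zero and are ignored (all statements about $T$, $\widetilde T$ as measurable maps are modulo null sets). Diffeomorphisms on the compact sets $I_\alpha$ are understood in the usual sense of being restrictions of $C^1$ diffeomorphisms of open neighborhoods. Existence and uniqueness of the fixed point of $\Theta$ is a known fact in this setting. The measures are finite but not necessarily normalized. "$(K,\widetilde{\mathcal{B}},m,\widetilde T)$ is a model for the natural extension of $(I,\mathcal{B},\mu,T)$" means that it is isomorphic, over $(I,\mathcal{B},\mu,T)$, to the natural extension. That is: $T$ preserves $\mu$; $\widetilde T$ is, modulo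 $m$-null sets, a bijection of $K$ preserving $m$; $\pi\circ\widetilde T=T\circ\pi$ almost everywhere, with $\pi_*m=\mu$; and, modulo null sets, a point of $K$ is determined by the bi-infinite sequence $(x_n)_{n\in\mathbb{Z}}$ with $x_n=\pi(\widetilde T^n(x,y))$ (equivalently, $\widetilde{\mathcal{B}}$ is generated modulo $m$-null sets by $\bigcup_{n\ge0}\widetilde T^{n}\pi^{-1}\mathcal{B}$). *)

theory Defs
  imports "HOL-Analysis.Analysis"
begin

definition regular_closed :: "'a::topological_space set \<Rightarrow> bool" where
  "regular_closed X \<longleftrightarrow> X = closure (interior X)"

definition C1_on ::
  "(real^'n) set \<Rightarrow> (real^'n \<Rightarrow> real^'n) \<Rightarrow> (real^'n \<Rightarrow> real^'n^'n) \<Rightarrow> bool" where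
  "C1_on U g G \<longleftrightarrow>
     (\<forall>x\<in>U. (g has_derivative (\<lambda>v. G x *v v)) (at x)) \<and> continuous_on U G"

definition C1_diffeo ::
  "(real^'n) set \<Rightarrow> (real^'n) set \<Rightarrow> (real^'n \<Rightarrow> real^'n) \<Rightarrow> (real^'n \<Rightarrow> real^'n^'n) \<Rightarrow> bool" where
  "C1_diffeo U V g G \<longleftrightarrow>
     open U \<and> open V \<and> C1_on U g G \<and> (\<exists>h H. homeomorphism U V g h \<and> C1_on V h H)"

text \<open>A diffeomorphism of a compact set \<open>D\<close> onto its image is a restriction of a \<open>C\<^sup>1\<close>
  diffeomorphism between open sets. If \<open>D\<close> is regular closed, the Jacobian \<open>DT\<close> is determined
  on \<open>D\<close> by \<open>T\<close>: on the interior it is the derivative of \<open>T\<close>, and it is continuous on \<open>D\<close>.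
  (The derivative within \<open>D\<close> need not be unique at boundary points, so it is not used here.)\<close>

definition diffeo_on_compact ::
  "(real^'n) set \<Rightarrow> (real^'n \<Rightarrow> real^'n) \<Rightarrow> (real^'n \<Rightarrow> real^'n^'n) \<Rightarrow> bool" where
  "diffeo_on_compact D T DT \<longleftrightarrow>
     (\<exists>U V g G. D \<subseteq> U \<and> C1_diffeo U V g G \<and> (\<forall>x\<in>D. T x = g x \<and> DT x = G x))"

definition piecewise_continuous_on ::
  "'a::euclidean_space set \<Rightarrow> ('a \<Rightarrow> 'b::topological_space) \<Rightarrow> bool" where
  "piecewise_continuous_on D f \<longleftrightarrow>
     (\<exists>P. finite P \<and> \<Union>P = D \<and>
          (\<forall>B\<in>P. compact B \<and> regular_closed B) \<and>
          (\<forall>B\<in>P. \<forall>B'\<in>P. B \<noteq> B' \<longrightarrow> negligible (B \<inter> B')) \<and>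
          (\<forall>B\<in>P. \<exists>g. continuous_on B g \<and> (\<forall>x\<in>interior B. f x = g x)))"

definition fibre_branch ::
  "('i \<Rightarrow> 'a \<Rightarrow> 'a) \<Rightarrow> ('i \<Rightarrow> 'a \<times> 'b \<Rightarrow> 'b) \<Rightarrow> 'i \<Rightarrow> 'a \<times> 'b \<Rightarrow> 'a \<times> 'b" where
  "fibre_branch T S \<alpha> z = (T \<alpha> (fst z), S \<alpha> z)"

definition over :: "('a \<times> 'b) set \<Rightarrow> 'a set \<Rightarrow> ('a \<times> 'b) set" where
  "over K D = {z \<in> K. fst z \<in> D}"

definition ext_image ::
  "'i set \<Rightarrow> ('i \<Rightarrow> 'a set) \<Rightarrow> ('i \<Rightarrow> 'a \<Rightarrow> 'a) \<Rightarrow> ('i \<Rightarrow> 'a \<times> 'b \<Rightarrow> 'b) \<Rightarrow>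
     ('a \<times> 'b) set \<Rightarrow> ('a \<times> 'b) set" where
  "ext_image A D T S K = (\<Union>\<alpha>\<in>A. fibre_branch T S \<alpha> ` over K (D \<alpha>))"

definition Theta ::
  "'i set \<Rightarrow> ('i \<Rightarrow> 'a set) \<Rightarrow> ('i \<Rightarrow> 'a \<Rightarrow> 'a) \<Rightarrow> ('i \<Rightarrow> 'a \<times> 'b \<Rightarrow> 'b) \<Rightarrow>
     ('a::topological_space \<times> 'b::topological_space) set \<Rightarrow> ('a \<times> 'b) set" where
  "Theta A D T S K = closure (ext_image A D T S K)"

definition compact_projecting_onto ::
  "'a::topological_space set \<Rightarrow> ('a \<times> 'b::topological_space) set \<Rightarrow> bool" where
  "compact_projecting_onto I K \<longleftrightarrow> compact K \<and> K \<subseteq> I \<times> UNIV \<and> fst ` K = I"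

definition unique_fixed_point_among :: "('a \<Rightarrow> bool) \<Rightarrow> ('a \<Rightarrow> 'a) \<Rightarrow> 'a \<Rightarrow> bool" where
  "unique_fixed_point_among P F k \<longleftrightarrow>
     P k \<and> F k = k \<and> (\<forall>k'. P k' \<and> F k' = k' \<longrightarrow> k' = k)"

definition marginal ::
  "'a::euclidean_space set \<Rightarrow> ('a \<times> 'b::euclidean_space) set \<Rightarrow> 'a measure" where
  "marginal I K = distr (restrict_space lborel K) (restrict_space borel I) fst"

text \<open>\<open>F\<close> is a measurable self-map of \<open>M\<close> representing, modulo null sets, the map that equals
  \<open>g \<alpha>\<close> on \<open>D \<alpha>\<close>; no value is prescribed on null sets, in particular on null overlaps.\<close>

definition ae_glued ::
  "'a measure \<Rightarrow> 'i set \<Rightarrow> ('i \<Rightarrow> 'a set) \<Rightarrow> ('i \<Rightarrow> 'a \<Rightarrow> 'a) \<Rightarrow> ('a \<Rightarrow> 'a) \<Rightarrow> bool" where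
  "ae_glued M A D g F \<longleftrightarrow>
     F \<in> M \<rightarrow>\<^sub>M M \<and> (\<forall>\<alpha>\<in>A. AE z in M. z \<in> D \<alpha> \<longrightarrow> F z = g \<alpha> z)"

text \<open>Such representatives exist if the pieces overlap in null sets.\<close>

lemma ae_glued_exists:
  assumes A: "countable A"
    and D: "\<And>\<alpha>. \<alpha> \<in> A \<Longrightarrow> D \<alpha> \<in> sets M" and cover: "(\<Union>\<alpha>\<in>A. D \<alpha>) = space M"
    and null: "\<And>\<alpha> \<beta>. \<alpha> \<in> A \<Longrightarrow> \<beta> \<in> A \<Longrightarrow> \<alpha> \<noteq> \<beta> \<Longrightarrow> D \<alpha> \<inter> D \<beta> \<in> null_sets M"
    and g: "\<And>\<alpha>. \<alpha> \<in> A \<Longrightarrow> g \<alpha> \<in> restrict_space M (D \<alpha>) \<rightarrow>\<^sub>M M"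
  shows "\<exists>F. ae_glued M A D g F"
proof -
  define E where "E \<alpha> = D \<alpha> - (\<Union>\<beta>\<in>{\<beta>\<in>A. to_nat_on A \<beta> < to_nat_on A \<alpha>}. D \<beta>)" for \<alpha>
  have E_sets: "E \<alpha> \<in> sets M" if "\<alpha> \<in> A" for \<alpha>
    unfolding E_def using D A that
    by (intro sets.Diff sets.countable_UN'') (auto intro: countable_subset[of _ A])
  have E_disj: "\<alpha> = \<beta>" if "\<alpha> \<in> A" "\<beta> \<in> A" "z \<in> E \<alpha>" "z \<in> E \<beta>" for \<alpha> \<beta> z
  proof -
    have "to_nat_on A \<alpha> = to_nat_on A \<beta>"
      using that unfolding E_def by (cases "to_nat_on A \<alpha>" "to_nat_on A \<beta>" rule: linorder_cases) auto
    thus ?thesis using A that by simp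
  qed
  have E_cover: "\<exists>\<alpha>\<in>A. z \<in> E \<alpha>" if "z \<in> space M" for z
  proof -
    have "\<exists>\<alpha>. \<alpha> \<in> A \<and> z \<in> D \<alpha>" using that cover by auto
    then obtain \<alpha> where "\<alpha> \<in> A" "z \<in> D \<alpha>"
      and "\<And>\<beta>. \<beta> \<in> A \<and> z \<in> D \<beta> \<Longrightarrow> to_nat_on A \<alpha> \<le> to_nat_on A \<beta>"
      using ex_has_least_nat[of "\<lambda>\<alpha>. \<alpha> \<in> A \<and> z \<in> D \<alpha>" _ "to_nat_on A"] by metis
    hence "z \<in> E \<alpha>" unfolding E_def by (auto simp: not_less[symmetric])
    with \<open>\<alpha> \<in> A\<close> show ?thesis by blast
  qed
  define F where "F z = g (THE \<alpha>. \<alpha> \<in> A \<and> z \<in> E \<alpha>) z" for z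
  have F: "F z = g \<alpha> z" if "\<alpha> \<in> A" "z \<in> E \<alpha>" for \<alpha> z
  proof -
    have "(THE \<alpha>. \<alpha> \<in> A \<and> z \<in> E \<alpha>) = \<alpha>" using that E_disj by blast
    thus ?thesis by (simp add: F_def)
  qed
  have "F \<in> M \<rightarrow>\<^sub>M M"
  proof (rule measurable_piecewise_restrict[of "E ` A"])
    show "countable (E ` A)" using A by simp
    show "space M \<subseteq> \<Union>(E ` A)" using E_cover by blast
    show "\<Omega> \<inter> space M \<in> sets M" if "\<Omega> \<in> E ` A" for \<Omega> using that E_sets by auto
    show "F \<in> restrict_space M \<Omega> \<rightarrow>\<^sub>M M" if \<Omega>: "\<Omega> \<in> E ` A" for \<Omega>
    proof -
      obtain \<alpha> where \<alpha>: "\<alpha> \<in> A" "\<Omega> = E \<alpha>" using \<Omega> by auto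
      have "g \<alpha> \<in> restrict_space (restrict_space M (D \<alpha>)) (E \<alpha>) \<rightarrow>\<^sub>M M"
        using g[OF \<alpha>(1)] by (rule measurable_restrict_space1)
      also have "restrict_space (restrict_space M (D \<alpha>)) (E \<alpha>) = restrict_space M (E \<alpha>)"
        using D \<alpha>(1) E_sets[OF \<alpha>(1)] 
        by (subst restrict_restrict_space) (auto simp: E_def Int_absorb1)
      finally show ?thesis
        using F \<alpha> by (subst measurable_cong[of _ _ "g \<alpha>"]) (auto simp: space_restrict_space)
    qed
  qed
  moreover have "AE z in M. z \<in> D \<alpha> \<longrightarrow> F z = g \<alpha> z" if \<alpha>: "\<alpha> \<in> A" for \<alpha>
  proof (rule AE_I')
    show "(\<Union>\<beta>\<in>A - {\<alpha>}. D \<alpha> \<inter> D \<beta>) \<in> null_sets M"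
      using A null \<alpha> by (intro null_sets_UN') auto
    show "{z \<in> space M. \<not> (z \<in> D \<alpha> \<longrightarrow> F z = g \<alpha> z)} \<subseteq> (\<Union>\<beta>\<in>A - {\<alpha>}. D \<alpha> \<inter> D \<beta>)"
    proof
      fix z assume "z \<in> {z \<in> space M. \<not> (z \<in> D \<alpha> \<longrightarrow> F z = g \<alpha> z)}"
      hence z: "z \<in> space M" "z \<in> D \<alpha>" "F z \<noteq> g \<alpha> z" by auto
      obtain \<beta> where "\<beta> \<in> A" "z \<in> E \<beta>" using E_cover z by blast
      with z F[of \<beta> z] show "z \<in> (\<Union>\<beta>\<in>A - {\<alpha>}. D \<alpha> \<inter> D \<beta>)" by (auto simp: E_def)
    qed
  qed
  ultimately show ?thesis unfolding ae_glued_def by blast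
qed

definition measure_preserving_map :: "'a measure \<Rightarrow> 'b measure \<Rightarrow> ('a \<Rightarrow> 'b) \<Rightarrow> bool" where
  "measure_preserving_map M N F \<longleftrightarrow> F \<in> M \<rightarrow>\<^sub>M N \<and> distr M N F = N"

definition int_iterate :: "'a set \<Rightarrow> ('a \<Rightarrow> 'a) \<Rightarrow> int \<Rightarrow> 'a \<Rightarrow> 'a" where
  "int_iterate X F n =
     (if n \<ge> 0 then F ^^ nat n else the_inv_into X F ^^ nat (- n))"

text \<open>\<open>(M, F)\<close>, with factor map \<open>p\<close>, is a model for the natural extension of \<open>(N, T)\<close>. After
  removal of a null set, \<open>F\<close> is a bimeasurable bijection of what remains, and points are separated
  by their two-sided sequences of projections. Separation of points characterizes the natural
  extension for standard Borel spaces, to which the definition is meant to be applied.\<close>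

definition natural_extension_model ::
  "'b measure \<Rightarrow> ('b \<Rightarrow> 'b) \<Rightarrow> ('b \<Rightarrow> 'a) \<Rightarrow> 'a measure \<Rightarrow> ('a \<Rightarrow> 'a) \<Rightarrow> bool" where
  "natural_extension_model M F p N T \<longleftrightarrow>
     measure_preserving_map N N T \<and>
     measure_preserving_map M M F \<and>
     measure_preserving_map M N p \<and>
     (AE z in M. p (F z) = T (p z)) \<and>
     (\<exists>X\<in>sets M.
        space M - X \<in> null_sets M \<and>
        bij_betw F X X \<and>
        the_inv_into X F \<in> restrict_space M X \<rightarrow>\<^sub>M restrict_space M X \<and>
        inj_on (\<lambda>z n. p (int_iterate X F n z)) X)"

end

theory Submission
  imports Defs
begin

text \<open>Each branch \<open>(x, y) \<mapsto> (T x, M x y + f x)\<close>, where \<open>M x\<close> is the inverse transpose of the Jacobian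
  of \<open>T\<close> at \<open>x\<close>, preserves Lebesgue measure by Fubini, because the determinants of base and fibre maps
  cancel. The images of the pieces of \<open>K\<close> cover \<open>K\<close> up to a null set and have the same total (finite)
  mass as the pieces, so the glued map preserves measure and these images overlap only in null sets.
  Hence it has an almost everywhere inverse, glued from the inverse branches. Along a two-sided
  orbit the base points determine the branches, and the fibre maps contract by \<open>1 / C\<close>. So two orbits
  in the bounded set \<open>K\<close> with the same base points have fibre distance at most \<open>b / C ^ k\<close> for all \<open>k\<close>,
  and they coincide.\<close>

section \<open>Linear renaming of coordinates\<close>

text \<open>\<open>T0\<close> and \<open>Tt\<close> are arbitrary representatives modulo null sets,
  whereas \<open>natural_extension_model\<close> asks for an honest bijection of one set
  \<open>X\<close> and for pointwise separation on it. Gluing the inverse branches yields only an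
  inverse \<open>R\<close> valid almost everywhere; \<open>X\<close> is then cut out as the points
  whose entire orbits under \<open>Tt\<close> and under \<open>R\<close> avoid an exceptional null
  set. Disjointness of the image pieces is not given but has to be derived. Counting the preimage of
  a set \<open>B\<close> branch by branch counts each point of \<open>B\<close> once for every image
  piece containing it, and almost every point is counted at least once because \<open>K\<close>
  minus its image is null. Hence preimages have at least the mass of \<open>B\<close>. Finiteness of
  the mass turns this into equality, and equality leaves no room for points counted twice.
  Finiteness comes from compactness of \<open>K\<close>. The fixed point equation enters through the
  inclusion of all branch images in \<open>K\<close>, which lets the whole argument run inside
  \<open>K\<close>.\<close>

lemma distr_lborel_Basis_isometry:
  fixes h :: "'a::euclidean_space \<Rightarrow> 'b::euclidean_space"
  assumes h: "linear h" and inner: "\<And>x y. h x \<bullet> h y = x \<bullet> y"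
    and Basis: "h ` Basis = Basis"
  shows "distr lborel borel h = lborel"
proof (rule lborel_eqI[symmetric])
  have [measurable]: "h \<in> borel \<rightarrow>\<^sub>M borel"
    using h by (intro borel_measurable_continuous_onI linear_continuous_on) (simp add: linear_linear)
  have inj: "inj_on h Basis"
    by (rule inj_onI) (metis inner inner_Basis zero_neq_one)
  have prod_h: "(\<Prod>b\<in>Basis. p b) = (\<Prod>b\<in>Basis. p (h b))" for p :: "'b \<Rightarrow> real"
    using prod.reindex[OF inj, of p] Basis by (simp add: o_def)
  have surj: "\<exists>x. h x = y" for y
  proof
    have "h (\<Sum>b\<in>Basis. (y \<bullet> h b) *\<^sub>R b) = (\<Sum>b\<in>Basis. (y \<bullet> h b) *\<^sub>R h b)"
      using h by (simp add: linear_sum linear_scale)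
    also have "\<dots> = (\<Sum>b\<in>h ` Basis. (y \<bullet> b) *\<^sub>R b)"
      by (subst sum.reindex[OF inj]) simp
    also have "\<dots> = y"
      by (simp add: Basis euclidean_representation)
    finally show "h (\<Sum>b\<in>Basis. (y \<bullet> h b) *\<^sub>R b) = y" .
  qed
  fix l u :: 'b assume le: "\<And>b. b \<in> Basis \<Longrightarrow> l \<bullet> b \<le> u \<bullet> b"
  obtain l' u' where l': "l = h l'" and u': "u = h u'"
    using surj by metis
  \<comment> \<open>A box is cut out by coordinates along \<open>Basis\<close>, and \<open>h\<close>
    matches the two bases, so pulling back only renames the sides. Box volumes determine
    \<open>lborel\<close>.\<close>
  have box: "h -` box l u = box l' u'"
    unfolding box_def l' u' Basis[symmetric] by (auto simp: inner)
  have le': "l' \<bullet> b \<le> u' \<bullet> b" if "b \<in> Basis" for b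
    using le[of "h b"] that Basis by (auto simp: l' u' inner)
  have "emeasure (distr lborel borel h) (box l u) = emeasure lborel (box l' u')"
    by (simp add: emeasure_distr box)
  also have "\<dots> = (\<Prod>b\<in>Basis. (u' - l') \<bullet> b)"
    using le' by (rule emeasure_lborel_box)
  also have "(\<Prod>b\<in>Basis. (u' - l') \<bullet> b) = (\<Prod>b\<in>Basis. (u - l) \<bullet> b)"
    unfolding prod_h[of "\<lambda>b. (u - l) \<bullet> b"] by (simp add: l' u' inner inner_diff_left)
  finally show "emeasure (distr lborel borel h) (box l u) = (\<Prod>b\<in>Basis. (u - l) \<bullet> b)" .
qed simp

text \<open>The library's change-of-variables theorems need a well-ordered index type, whereas \<open>'n\<close> is
  merely finite; coordinates are therefore renamed by a copy of \<open>'n\<close> carrying an enumeration order.\<close>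

typedef 'a enumerated = "UNIV :: 'a set" ..

instantiation enumerated :: (finite) wellorder
begin

definition "x \<le> y \<longleftrightarrow>
  to_nat_on UNIV (Rep_enumerated x) \<le> to_nat_on UNIV (Rep_enumerated (y :: 'a enumerated))"

definition "x < y \<longleftrightarrow>
  to_nat_on UNIV (Rep_enumerated x) < to_nat_on UNIV (Rep_enumerated (y :: 'a enumerated))"

instance
proof
  fix x y :: "'a enumerated"
  assume "x \<le> y" "y \<le> x"
  hence "to_nat_on UNIV (Rep_enumerated x) = to_nat_on UNIV (Rep_enumerated y)"
    by (simp add: less_eq_enumerated_def)
  thus "x = y"
    by (subst (asm) inj_on_to_nat_on[THEN inj_on_eq_iff])
       (auto simp: Rep_enumerated_inject countable_finite)
next
  fix P :: "'a enumerated \<Rightarrow> bool" and x :: "'a enumerated"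
  assume IH: "\<And>x. (\<And>y. y < x \<Longrightarrow> P y) \<Longrightarrow> P x"
  show "P x"
    by (induction "to_nat_on UNIV (Rep_enumerated x)" arbitrary: x rule: less_induct)
       (auto intro: IH simp: less_enumerated_def)
qed (auto simp: less_eq_enumerated_def less_enumerated_def)

end

instance enumerated :: (finite) finite
proof
  show "finite (UNIV :: 'a enumerated set)"
    unfolding type_definition.univ[OF type_definition_enumerated] by (intro finite_imageI finite)
qed

definition reindex :: "real^'n \<Rightarrow> real^('n::finite enumerated)" where
  "reindex x = (\<chi> i. x $ Rep_enumerated i)"

definition unindex :: "real^('n::finite enumerated) \<Rightarrow> real^'n" where
  "unindex x = (\<chi> i. x $ Abs_enumerated i)"

lemma unindex_reindex [simp]: "unindex (reindex x) = x"
  by (simp add: vec_eq_iff reindex_def unindex_def Abs_enumerated_inverse)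

lemma reindex_unindex [simp]: "reindex (unindex x) = x"
  by (simp add: vec_eq_iff reindex_def unindex_def Rep_enumerated_inverse)

lemma linear_reindex: "linear reindex"
  by (rule linearI) (auto simp: reindex_def vec_eq_iff)

lemma linear_unindex: "linear unindex"
  by (rule linearI) (auto simp: unindex_def vec_eq_iff)

lemma bij_Rep_enumerated: "bij Rep_enumerated"
  by (rule o_bij[of Abs_enumerated])
     (auto simp: fun_eq_iff Rep_enumerated_inverse Abs_enumerated_inverse)

lemma inner_reindex: "reindex x \<bullet> reindex y = x \<bullet> y"
  unfolding inner_vec_def reindex_def
  using sum.reindex_bij_betw[OF bij_Rep_enumerated, of "\<lambda>i. x $ i \<bullet> y $ i"] by simp

lemma reindex_axis: "reindex (axis i c) = axis (Abs_enumerated i) c"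
  by (auto simp: vec_eq_iff reindex_def axis_def Abs_enumerated_inverse Rep_enumerated_inverse)

lemma reindex_Basis: "reindex ` Basis = Basis"
proof -
  have "range (\<lambda>i. axis (Abs_enumerated i) (1::real)) = (\<lambda>i. axis i 1) ` range Abs_enumerated"
    by (simp add: image_image)
  also have "range Abs_enumerated = UNIV"
    using type_definition.Abs_image[OF type_definition_enumerated] .
  finally show ?thesis
    by (simp add: Basis_vec_def image_image reindex_axis UNION_singleton_eq_range)
qed

text \<open>Base and fibre are renamed simultaneously, so that measures of sets in the product can
  be computed in renamed coordinates.\<close>

lemma distr_lborel_reindex_prod:
  "distr lborel borel (\<lambda>z. (reindex (fst z), reindex (snd z))) = lborel"
proof (rule distr_lborel_Basis_isometry)
  show "linear (\<lambda>z. (reindex (fst z), reindex (snd z)))"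
    by (intro linearI) (auto simp: linear_add[OF linear_reindex] linear_scale[OF linear_reindex])
  show "(\<lambda>z. (reindex (fst z), reindex (snd z))) ` Basis = Basis"
    unfolding Basis_prod_def reindex_Basis[symmetric] image_Un image_image
    by (simp add: linear_0[OF linear_reindex] cong: image_cong)
qed (simp add: inner_prod_def inner_reindex)

section \<open>Measure preservation of skew products\<close>

text \<open>The determinant is a polynomial in the entries, and the entries are coordinates of
  \<open>L x\<close> at fixed axis vectors.\<close>

lemma borel_measurable_det_matrix:
  fixes L :: "'a::topological_space \<Rightarrow> real^'n \<Rightarrow> real^'n"
  assumes "\<And>v. continuous_on D (\<lambda>x. L x v)"
  shows "(\<lambda>x. det (matrix (L x))) \<in> borel_measurable (restrict_space borel D)"
proof (rule borel_measurable_continuous_on_restrict)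
  show "continuous_on D (\<lambda>x. det (matrix (L x)))"
    unfolding det_def matrix_def by (simp, intro continuous_intros assms)
qed

text \<open>On a compact set a continuous injection has a continuous inverse, and the image of
  \<open>S\<close> is the preimage of \<open>S\<close> under that inverse. This avoids the
  Lusin-Souslin theorem.\<close>

lemma sets_borel_inj_image:
  fixes T :: "'a::t2_space \<Rightarrow> 'b::t2_space"
  assumes D: "compact D" and T: "continuous_on D T" "inj_on T D"
    and S: "S \<subseteq> D" "S \<in> sets borel"
  shows "T ` S \<in> sets borel"
proof -
  have cont: "continuous_on (T ` D) (inv_into D T)"
    by (rule continuous_on_inv[OF T(1) D]) (simp add: T(2))
  have eq: "T ` S = inv_into D T -` S \<inter> T ` D"
    using S T(2) by (force simp: inv_into_f_f subset_iff)
  have "T ` D \<in> sets borel"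
    using compact_continuous_image[OF T(1) D] by (simp add: borel_compact)
  thus ?thesis
    using measurable_sets[OF borel_measurable_continuous_on_restrict[OF cont] S(2)]
    unfolding eq by (simp add: sets_restrict_space_iff space_restrict_space)
qed

lemma sets_borel_skew_product_vimage:
  fixes T :: "'a::second_countable_topology \<Rightarrow> 'c::second_countable_topology"
    and S :: "'a \<times> 'b::second_countable_topology \<Rightarrow> 'd::second_countable_topology"
  assumes D: "closed D" and T: "continuous_on D T" and S: "continuous_on (D \<times> UNIV) S"
    and B: "B \<in> sets borel"
  shows "{z \<in> D \<times> UNIV. (T (fst z), S z) \<in> B} \<in> sets borel"
proof -
  have cont: "continuous_on (D \<times> UNIV) (\<lambda>z. (T (fst z), S z))"
    by (intro continuous_intros S continuous_on_compose2[OF T]) auto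
  have "(\<lambda>z. (T (fst z), S z)) -` B \<inter> (D \<times> UNIV) \<in> sets borel"
    using measurable_sets[OF borel_measurable_continuous_on_restrict[OF cont] B] D
    by (simp add: sets_restrict_space_iff space_restrict_space borel_closed closed_Times)
  also have "(\<lambda>z. (T (fst z), S z)) -` B \<inter> (D \<times> UNIV) = {z \<in> D \<times> UNIV. (T (fst z), S z) \<in> B}"
    by auto
  finally show ?thesis .
qed

text \<open>Bridges \<open>lborel\<close> with extended values and the real-valued
  \<open>measure lebesgue\<close>; boundedness excludes infinite measure, to which
  \<open>measure\<close> assigns 0.\<close>

lemma emeasure_lborel_eq_measure_lebesgue:
  assumes "S \<in> sets borel" "bounded S"
  shows "emeasure lborel S = ennreal (measure lebesgue S)"
  using assms emeasure_bounded_finite[of S]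
  by (simp add: measure_completion emeasure_eq_ennreal_measure less_top)

text \<open>Compactness of \<open>D\<close> serves twice: it makes the image of a Borel set Borel,
  and it bounds that image, so that the real-valued area formula transfers to
  \<open>emeasure\<close>.\<close>

lemma emeasure_differentiable_image:
  fixes T :: "real^'n::{finite,wellorder} \<Rightarrow> real^'n::_"
  assumes D: "compact D" and T: "\<And>x. x \<in> D \<Longrightarrow> (T has_derivative L x) (at x within D)"
    and inj: "inj_on T D" and S: "S \<subseteq> D" "S \<in> sets borel"
  shows "emeasure lborel (T ` S) = (\<integral>\<^sup>+x. ennreal \<bar>det (matrix (L x))\<bar> * indicator S x \<partial>lborel)"
proof -
  have cont: "continuous_on D T"
    using T by (rule has_derivative_continuous_on)
  have borel: "T ` S \<in> sets borel"
    by (rule sets_borel_inj_image[OF D cont inj S])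
  have bdd: "bounded (T ` S)"
    using compact_imp_bounded[OF compact_continuous_image[OF cont D]] S
    by (meson bounded_subset image_mono)
  have "T ` S \<in> lmeasurable"
    using borel bdd by (intro bounded_set_imp_lmeasurable) auto
  hence "((\<lambda>x. \<bar>det (matrix (L x))\<bar>) has_integral measure lebesgue (T ` S)) S"
    using has_measure_differentiable_image[of S T L "measure lebesgue (T ` S)"] T S inj
    by (auto intro: has_derivative_subset inj_on_subset)
  from nn_integral_has_integral_lebesgue'[OF _ this]
  show ?thesis
    by (simp add: emeasure_lborel_eq_measure_lebesgue[OF borel bdd])
qed

text \<open>The preceding area formula says that two measures agree: the push-forward under
  \<open>T\<close> of the density given by the Jacobian on \<open>D\<close>, and Lebesgue measure on
  the image of \<open>D\<close>. Integrating \<open>\<phi>\<close> against both gives the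
  claim.\<close>

lemma nn_integral_C1_change_of_variables:
  fixes T :: "real^'n::{finite,wellorder} \<Rightarrow> real^'n::_"
  assumes D: "compact D" and T: "\<And>x. x \<in> D \<Longrightarrow> (T has_derivative L x) (at x within D)"
    and inj: "inj_on T D" and L: "\<And>v. continuous_on D (\<lambda>x. L x v)"
    and \<phi>[measurable]: "\<phi> \<in> borel_measurable borel"
  shows "(\<integral>\<^sup>+x. \<phi> x * indicator (T ` D) x \<partial>lborel) =
    (\<integral>\<^sup>+x. ennreal \<bar>det (matrix (L x))\<bar> * \<phi> (T x) * indicator D x \<partial>lborel)"
proof -
  let ?M = "restrict_space lborel D"
  let ?J = "\<lambda>x. ennreal \<bar>det (matrix (L x))\<bar>"
  have cont: "continuous_on D T"
    using T by (rule has_derivative_continuous_on)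
  have [measurable]: "D \<in> sets borel" "T ` D \<in> sets borel"
    using D compact_continuous_image[OF cont D] by (auto simp: borel_compact)
  have J[measurable]: "?J \<in> borel_measurable ?M"
    using borel_measurable_det_matrix[of D L, OF L]
    by (auto simp: cong: measurable_cong_sets sets_restrict_space_cong)
  have TM[measurable]: "T \<in> ?M \<rightarrow>\<^sub>M borel"
    using borel_measurable_continuous_on_restrict[OF cont]
    by (auto simp: cong: measurable_cong_sets sets_restrict_space_cong)
  have eq: "distr (density ?M ?J) borel T = density lborel (indicator (T ` D))"
  proof (rule measure_eqI)
    fix A assume "A \<in> sets (distr (density ?M ?J) borel T)"
    hence A[measurable]: "A \<in> sets borel" by simp
    have TA: "T -` A \<inter> D \<in> sets borel"
      using measurable_sets[OF TM A] by (simp add: sets_restrict_space_iff space_restrict_space)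
    have "emeasure (distr (density ?M ?J) borel T) A = emeasure (density ?M ?J) (T -` A \<inter> D)"
      by (simp add: emeasure_distr space_restrict_space)
    also have "\<dots> = (\<integral>\<^sup>+x. ?J x * indicator (T -` A \<inter> D) x \<partial>?M)"
      using measurable_sets[OF TM A] by (subst emeasure_density[OF J]) (auto simp: space_restrict_space)
    also have "\<dots> = (\<integral>\<^sup>+x. ?J x * indicator (T -` A \<inter> D) x \<partial>lborel)"
      by (subst nn_integral_restrict_space) (auto intro!: nn_integral_cong split: split_indicator)
    also have "\<dots> = emeasure lborel (T ` (T -` A \<inter> D))"
      by (rule emeasure_differentiable_image[OF D T inj _ TA, symmetric]) auto
    also have "T ` (T -` A \<inter> D) = A \<inter> T ` D"
      by auto
    also have "emeasure lborel (A \<inter> T ` D) = emeasure (density lborel (indicator (T ` D))) A"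
      by (simp add: emeasure_density indicator_inter_arith[symmetric] Int_commute)
    finally show "emeasure (distr (density ?M ?J) borel T) A =
      emeasure (density lborel (indicator (T ` D))) A" .
  qed simp
  have "(\<integral>\<^sup>+x. \<phi> x * indicator (T ` D) x \<partial>lborel) = (\<integral>\<^sup>+x. \<phi> x \<partial>density lborel (indicator (T ` D)))"
    by (simp add: nn_integral_density mult.commute)
  also have "\<dots> = (\<integral>\<^sup>+x. ?J x * \<phi> (T x) \<partial>?M)"
    unfolding eq[symmetric] by (simp add: nn_integral_distr nn_integral_density[OF J])
  also have "\<dots> = (\<integral>\<^sup>+x. ?J x * \<phi> (T x) * indicator D x \<partial>lborel)"
    by (simp add: nn_integral_restrict_space)
  finally show ?thesis .
qed

text \<open>As \<open>M\<close> inverts the adjoint, the preimage is the adjoint applied to a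
  translate of \<open>B\<close>. A matrix and its transpose have the same determinant, so the factor
  is the very Jacobian produced by the base map.\<close>

lemma emeasure_adjoint_inverse_vimage:
  fixes L M :: "real^'n::{finite,wellorder} \<Rightarrow> real^'n::_"
  assumes L: "linear L" and inv: "\<And>y. adjoint L (M y) = y" "\<And>y. M (adjoint L y) = y"
    and B: "B \<in> sets borel" "bounded B"
  shows "emeasure lborel {y. M y + c \<in> B} = ennreal \<bar>det (matrix L)\<bar> * emeasure lborel B"
proof -
  let ?B = "(\<lambda>b. b - c) ` B"
  have adj: "linear (adjoint L)" using L by (rule adjoint_linear)
  have eq: "{y. M y + c \<in> B} = adjoint L ` ?B"
  proof (intro equalityI subsetI)
    fix y assume "y \<in> {y. M y + c \<in> B}"
    thus "y \<in> adjoint L ` ?B"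
      using inv(1)[of y] by (intro image_eqI[of _ _ "M y"] image_eqI[of _ _ "M y + c"]) auto
  qed (auto simp: inv)
  have B': "B \<in> lmeasurable"
    using B by (intro bounded_set_imp_lmeasurable) auto
  have bdd: "bounded (adjoint L ` ?B)"
    using B(2) adj by (intro bounded_linear_image bounded_translation_minus) (auto simp: linear_linear)
  \<comment> \<open>Linearity is inherited from the adjoint, of which \<open>M\<close> is a
    two-sided inverse.\<close>
  have "linear M"
  proof (rule linearI)
    show "M (x + y) = M x + M y" for x y
      using inv(2)[of "M x + M y"] by (simp add: linear_add[OF adj] inv(1))
    show "M (r *\<^sub>R x) = r *\<^sub>R M x" for r x
      using inv(2)[of "r *\<^sub>R M x"] by (simp add: linear_scale[OF adj] inv(1))
  qed
  hence "(\<lambda>y. M y + c) \<in> borel \<rightarrow>\<^sub>M borel"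
    by (intro borel_measurable_continuous_onI continuous_intros linear_continuous_on)
       (simp add: linear_linear)
  from measurable_sets_borel[OF this B(1)] have borel: "adjoint L ` ?B \<in> sets borel"
    unfolding eq[symmetric] by (simp add: vimage_def)
  have "measure lebesgue (adjoint L ` ?B) = \<bar>det (matrix L)\<bar> * measure lebesgue B"
    using B' L by (simp add: measure_linear_image[OF adj] measurable_translation_subtract
        measure_translation_subtract matrix_adjoint)
  thus ?thesis
    unfolding eq using borel bdd B
    by (simp add: emeasure_lborel_eq_measure_lebesgue ennreal_mult)
qed

text \<open>The fibre offset \<open>f\<close> is not differentiable in \<open>x\<close>, so the skew product has no Jacobian; by Fubini
  only the base map needs a change of variables, and its determinant cancels that of the fibre maps.\<close>

lemma emeasure_skew_product_wellorder:
  fixes T :: "real^'n::{finite,wellorder} \<Rightarrow> real^'n::_" and S :: "(real^'n::_) \<times> (real^'n::_) \<Rightarrow> real^'n::_"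
  assumes D: "compact D" and T: "\<And>x. x \<in> D \<Longrightarrow> (T has_derivative L x) (at x within D)"
    and inj: "inj_on T D" and L: "\<And>v. continuous_on D (\<lambda>x. L x v)"
    and S: "continuous_on (D \<times> UNIV) S" "\<And>x y. x \<in> D \<Longrightarrow> S (x, y) = M x y + f x"
    and inv: "\<And>x y. x \<in> D \<Longrightarrow> adjoint (L x) (M x y) = y"
      "\<And>x y. x \<in> D \<Longrightarrow> M x (adjoint (L x) y) = y"
    and B: "B \<in> sets borel" "bounded B"
  shows "emeasure lborel (B \<inter> T ` D \<times> UNIV) =
    emeasure lborel {z \<in> D \<times> UNIV. (T (fst z), S z) \<in> B}"
proof -
  have cont: "continuous_on D T"
    using T by (rule has_derivative_continuous_on)
  have closed: "closed D" "closed (T ` D)"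
    using D compact_continuous_image[OF cont D] by (auto intro: compact_imp_closed)
  have prod: "sets (lborel \<Otimes>\<^sub>M lborel) = sets (borel :: ((real^'n::_) \<times> (real^'n::_)) measure)"
    by (metis lborel_prod sets_lborel)
  have W: "B \<inter> T ` D \<times> UNIV \<in> sets (lborel \<Otimes>\<^sub>M lborel)"
    unfolding prod using closed by (intro sets.Int[OF B(1)] borel_closed closed_Times) auto
  let ?Z = "{z \<in> D \<times> UNIV. (T (fst z), S z) \<in> B}"
  have Z: "?Z \<in> sets (lborel \<Otimes>\<^sub>M lborel)"
    unfolding prod by (rule sets_borel_skew_product_vimage[OF closed(1) cont S(1) B(1)])
  have B': "B \<in> sets (lborel \<Otimes>\<^sub>M lborel)"
    unfolding prod by (rule B(1))
  have sec: "Pair x -` B \<in> sets borel" for x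
    using sets_Pair1[OF B', of x] by simp
  have sec_bdd: "bounded (Pair x -` B)" for x
    by (rule bounded_subset[OF bounded_snd[OF B(2)]]) force
  have [measurable]: "(\<lambda>x. emeasure lborel (Pair x -` B)) \<in> borel_measurable borel"
    using lborel.measurable_emeasure_Pair[OF B'] by simp
  have "emeasure lborel (B \<inter> T ` D \<times> UNIV) =
      (\<integral>\<^sup>+x. emeasure lborel (Pair x -` (B \<inter> T ` D \<times> UNIV)) \<partial>lborel)"
    using lborel.emeasure_pair_measure_alt[OF W] by (simp add: lborel_prod)
  also have "\<dots> = (\<integral>\<^sup>+x. emeasure lborel (Pair x -` B) * indicator (T ` D) x \<partial>lborel)"
    by (intro nn_integral_cong) (auto simp: vimage_def split: split_indicator)
  \<comment> \<open>Here \<open>\<phi> x\<close> is the measure of the slice of \<open>B\<close>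
    above \<open>x\<close>.\<close>
  also have "\<dots> = (\<integral>\<^sup>+x. ennreal \<bar>det (matrix (L x))\<bar> *
      emeasure lborel (Pair (T x) -` B) * indicator D x \<partial>lborel)"
    by (rule nn_integral_C1_change_of_variables[OF D T inj L]) auto
  \<comment> \<open>The slice of \<open>?Z\<close> above \<open>x\<close> is the preimage, under the
    fibre map at \<open>x\<close>, of the slice of \<open>B\<close> above \<open>T x\<close>; taking
    this preimage multiplies measure by the same determinant.\<close>
  also have "\<dots> = (\<integral>\<^sup>+x. emeasure lborel (Pair x -` ?Z) \<partial>lborel)"
  proof (intro nn_integral_cong)
    fix x :: "real^'n::_"
    show "ennreal \<bar>det (matrix (L x))\<bar> * emeasure lborel (Pair (T x) -` B) * indicator D x =
      emeasure lborel (Pair x -` ?Z)"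
    proof (cases "x \<in> D")
      case True
      have "linear (L x)" using has_derivative_linear[OF T[OF True]] .
      from emeasure_adjoint_inverse_vimage[OF this inv[OF True] sec sec_bdd, of "f x" "T x"] True
      show ?thesis by (simp add: vimage_def S(2))
    qed (simp add: vimage_def)
  qed
  also have "\<dots> = emeasure lborel ?Z"
    using lborel.emeasure_pair_measure_alt[OF Z] by (simp add: lborel_prod)
  finally show ?thesis .
qed

text \<open>Conjugation by the coordinate renaming reduces this to the well-ordered case. Every
  hypothesis survives because the renaming is a linear isometry, and the product measure is
  unchanged.\<close>

lemma emeasure_skew_product:
  fixes T :: "real^'n \<Rightarrow> real^'n" and S :: "(real^'n) \<times> (real^'n) \<Rightarrow> real^'n"
  assumes D: "compact D" and T: "\<And>x. x \<in> D \<Longrightarrow> (T has_derivative L x) (at x within D)"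
    and inj: "inj_on T D" and L: "\<And>v. continuous_on D (\<lambda>x. L x v)"
    and S: "continuous_on (D \<times> UNIV) S" "\<And>x y. x \<in> D \<Longrightarrow> S (x, y) = M x y + f x"
    and inv: "\<And>x y. x \<in> D \<Longrightarrow> adjoint (L x) (M x y) = y"
      "\<And>x y. x \<in> D \<Longrightarrow> M x (adjoint (L x) y) = y"
    and B: "B \<in> sets borel" "bounded B"
  shows "emeasure lborel (B \<inter> T ` D \<times> UNIV) =
    emeasure lborel {z \<in> D \<times> UNIV. (T (fst z), S z) \<in> B}"
proof -
  let ?r = "reindex :: real^'n \<Rightarrow> _" and ?u = "unindex :: _ \<Rightarrow> real^'n"
  define r2 where "r2 z = (?r (fst z), ?r (snd z))" for z
  define u2 where "u2 z = (?u (fst z), ?u (snd z))" for z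
  have r2_u2 [simp]: "r2 (u2 z) = z" and u2_r2 [simp]: "u2 (r2 z') = z'" for z z'
    by (simp_all add: r2_def u2_def)
  have fst_r2: "fst (r2 z) = ?r (fst z)" for z by (simp add: r2_def)
  have cont_u: "continuous_on X ?u" and cont_r: "continuous_on Y ?r" for X Y
    using linear_unindex linear_reindex by (auto intro: linear_continuous_on simp: linear_linear)
  have u2_meas: "u2 \<in> borel \<rightarrow>\<^sub>M borel"
    unfolding u2_def by (intro borel_measurable_continuous_onI continuous_intros
        continuous_on_compose2[OF cont_u[of UNIV]]) auto
  have r2_meas: "r2 \<in> borel \<rightarrow>\<^sub>M borel"
    unfolding r2_def by (intro borel_measurable_continuous_onI continuous_intros
        continuous_on_compose2[OF cont_r[of UNIV]]) auto
  have transport: "emeasure lborel W = emeasure lborel (r2 -` W)" if "W \<in> sets borel" for W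
  proof -
    have "emeasure lborel W = emeasure (distr lborel borel r2) W"
      unfolding r2_def by (simp add: distr_lborel_reindex_prod)
    also have "\<dots> = emeasure lborel (r2 -` W)"
      using r2_meas that by (simp add: emeasure_distr)
    finally show ?thesis .
  qed
  define D' where "D' = ?r ` D"
  define T' where "T' = (\<lambda>x. ?r (T (?u x)))"
  define L' where "L' = (\<lambda>x v. ?r (L (?u x) (?u v)))"
  define M' where "M' = (\<lambda>x v. ?r (M (?u x) (?u v)))"
  define f' where "f' = (\<lambda>x. ?r (f (?u x)))"
  define S' where "S' = (\<lambda>z. ?r (S (u2 z)))"
  define B' where "B' = u2 -` B"
  have D': "compact D'"
    unfolding D'_def by (intro compact_continuous_image cont_r D)
  have u_D': "?u ` D' = D" and in_D': "x \<in> D' \<longleftrightarrow> ?u x \<in> D" for x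
    by (force simp: D'_def image_image)+
  have T': "(T' has_derivative L' x) (at x within D')" if "x \<in> D'" for x
  proof -
    have u: "(?u has_derivative ?u) (at x within D')" and r: "\<And>y. (?r has_derivative ?r) (at y)"
      using linear_unindex linear_reindex
      by (auto intro: bounded_linear_imp_has_derivative simp: linear_linear)
    have "(T has_derivative L (?u x)) (at (?u x) within ?u ` D')"
      unfolding u_D' using T that by (simp add: in_D')
    from has_derivative_in_compose[OF u this] 
    have "((\<lambda>x. T (?u x)) has_derivative (\<lambda>v. L (?u x) (?u v))) (at x within D')" .
    from has_derivative_compose[OF this r] show ?thesis
      by (simp add: T'_def L'_def)
  qed
  have inj': "inj_on T' D'"
  proof (rule inj_onI)
    fix x y assume x: "x \<in> D'" and y: "y \<in> D'" and eq: "T' x = T' y"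
    have "T (?u x) = T (?u y)"
      using arg_cong[OF eq, of ?u] by (simp add: T'_def)
    hence "?u x = ?u y"
      using inj_onD[OF inj] x y by (simp add: in_D')
    from arg_cong[OF this, of ?r] show "x = y" by simp
  qed
  have L': "continuous_on D' (\<lambda>x. L' x v)" for v
    unfolding L'_def
    by (intro continuous_on_compose2[OF cont_r[of UNIV]] continuous_on_compose2[OF L] cont_u)
       (auto simp: in_D')
  have cont_u2: "continuous_on (D' \<times> UNIV) u2"
    unfolding u2_def
    by (intro continuous_intros continuous_on_compose2[OF cont_u[of UNIV]]) auto
  have S': "continuous_on (D' \<times> UNIV) S'"
    unfolding S'_def
    by (intro continuous_on_compose2[OF cont_r[of UNIV]] continuous_on_compose2[OF S(1)] cont_u2)
       (auto simp: in_D' u2_def)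
  have S'_eq: "S' (x, y) = M' x y + f' x" if "x \<in> D'" for x y
    using S(2)[of "?u x" "?u y"] that
    by (simp add: S'_def M'_def f'_def u2_def in_D' linear_add[OF linear_reindex])
  \<comment> \<open>Preservation of the inner product is what makes the adjoint commute with the
    renaming.\<close>
  have adj: "adjoint (L' x) = (\<lambda>y. ?r (adjoint (L (?u x)) (?u y)))" if "x \<in> D'" for x
  proof (rule adjoint_unique, intro allI)
    fix v w
    have lin: "linear (L (?u x))"
      using T[of "?u x"] that by (auto simp: in_D' intro: has_derivative_linear)
    have "L' x v \<bullet> w = L (?u x) (?u v) \<bullet> ?u w"
      using inner_reindex[of "L (?u x) (?u v)" "?u w"] by (simp add: L'_def)
    also have "\<dots> = ?u v \<bullet> adjoint (L (?u x)) (?u w)"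
      by (simp add: adjoint_works[OF lin])
    also have "\<dots> = v \<bullet> ?r (adjoint (L (?u x)) (?u w))"
      using inner_reindex[of "?u v" "adjoint (L (?u x)) (?u w)"] by simp
    finally show "L' x v \<bullet> w = v \<bullet> ?r (adjoint (L (?u x)) (?u w))" .
  qed
  have inv': "adjoint (L' x) (M' x y) = y" "M' x (adjoint (L' x) y) = y" if "x \<in> D'" for x y
    using inv that by (simp_all add: adj M'_def in_D')
  have B': "B' \<in> sets borel" "bounded B'"
  proof -
    show "B' \<in> sets borel"
      unfolding B'_def using measurable_sets_borel[OF u2_meas B(1)] by simp
    have "linear r2"
      unfolding r2_def
      by (intro linearI) (auto simp: linear_add[OF linear_reindex] linear_scale[OF linear_reindex])
    hence "bounded (r2 ` B)"
      using B(2) by (intro bounded_linear_image) (auto simp: linear_linear)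
    moreover have "B' = r2 ` B"
      unfolding B'_def by (intro set_eqI) (metis image_iff r2_u2 u2_r2 vimage_eq)
    ultimately show "bounded B'" by simp
  qed
  have "closed D'" "closed (T' ` D')" "continuous_on D' T'"
    using D' T' compact_continuous_image[of D' T'] has_derivative_continuous_on[of D' T' L']
    by (auto intro: compact_imp_closed)
  have "B' \<inter> T' ` D' \<times> UNIV \<in> sets borel"
    using \<open>closed (T' ` D')\<close> by (intro sets.Int[OF B'(1)] borel_closed closed_Times) auto
  moreover have "r2 -` (B' \<inter> T' ` D' \<times> UNIV) = B \<inter> T ` D \<times> UNIV"
  proof -
    have "T' ` D' = ?r ` T ` D"
      by (force simp: T'_def D'_def image_image)
    hence "?r x \<in> T' ` D' \<longleftrightarrow> x \<in> T ` D" for x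
      by (simp add: inj_image_mem_iff[OF inj_on_inverseI[of _ ?u]])
    thus ?thesis
      by (intro set_eqI) (simp add: B'_def mem_Times_iff fst_r2)
  qed
  ultimately have "emeasure lborel (B \<inter> T ` D \<times> UNIV) = emeasure lborel (B' \<inter> T' ` D' \<times> UNIV)"
    using transport[of "B' \<inter> T' ` D' \<times> UNIV"] by simp
  also have "\<dots> = emeasure lborel {z \<in> D' \<times> UNIV. (T' (fst z), S' z) \<in> B'}"
    by (rule emeasure_skew_product_wellorder[OF D' T' inj' L' S' S'_eq inv' B'])
  also have "\<dots> = emeasure lborel (r2 -` {z \<in> D' \<times> UNIV. (T' (fst z), S' z) \<in> B'})"
    using sets_borel_skew_product_vimage[OF \<open>closed D'\<close> \<open>continuous_on D' T'\<close> S' B'(1)]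
    by (rule transport)
  also have "r2 -` {z \<in> D' \<times> UNIV. (T' (fst z), S' z) \<in> B'} =
      {z \<in> D \<times> UNIV. (T (fst z), S z) \<in> B}"
  proof (rule set_eqI)
    fix z
    have "(T' (fst (r2 z)), S' (r2 z)) = r2 (T (fst z), S z)"
      by (simp add: T'_def S'_def fst_r2) (simp add: r2_def)
    thus "z \<in> r2 -` {z \<in> D' \<times> UNIV. (T' (fst z), S' z) \<in> B'} \<longleftrightarrow>
        z \<in> {z \<in> D \<times> UNIV. (T (fst z), S z) \<in> B}"
      by (simp add: B'_def in_D' mem_Times_iff fst_r2)
  qed
  finally show ?thesis .
qed

section \<open>Gluing measure-preserving branches\<close>

text \<open>Each point is assigned to the piece of least index in an enumeration of
  \<open>A\<close>, so a piece loses only points that it shares with others.\<close>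

lemma disjointify_countable:
  assumes A: "countable A" and P: "\<And>\<alpha>. \<alpha> \<in> A \<Longrightarrow> P \<alpha> \<in> sets M"
  shows "\<exists>E. (\<forall>\<alpha>\<in>A. E \<alpha> \<in> sets M \<and> E \<alpha> \<subseteq> P \<alpha> \<and>
      P \<alpha> - E \<alpha> \<subseteq> (\<Union>\<beta>\<in>A - {\<alpha>}. P \<alpha> \<inter> P \<beta>)) \<and>
    disjoint_family_on E A \<and> (\<Union>\<alpha>\<in>A. E \<alpha>) = (\<Union>\<alpha>\<in>A. P \<alpha>)"
proof -
  define E where "E \<alpha> = P \<alpha> - (\<Union>\<beta>\<in>{\<beta>\<in>A. to_nat_on A \<beta> < to_nat_on A \<alpha>}. P \<beta>)" for \<alpha>
  have 1: "E \<alpha> \<in> sets M" if "\<alpha> \<in> A" for \<alpha>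
    unfolding E_def using P A that
    by (intro sets.Diff sets.countable_UN'') (auto intro: countable_subset[of _ A])
  have 2: "P \<alpha> - E \<alpha> \<subseteq> (\<Union>\<beta>\<in>A - {\<alpha>}. P \<alpha> \<inter> P \<beta>)" for \<alpha>
    by (auto simp: E_def)
  have "\<alpha> = \<beta>" if "\<alpha> \<in> A" "\<beta> \<in> A" "z \<in> E \<alpha>" "z \<in> E \<beta>" for \<alpha> \<beta> z
  proof -
    have "to_nat_on A \<alpha> = to_nat_on A \<beta>"
      using that unfolding E_def by (cases "to_nat_on A \<alpha>" "to_nat_on A \<beta>" rule: linorder_cases) auto
    thus ?thesis using A that by simp
  qed
  hence 3: "disjoint_family_on E A"
    unfolding disjoint_family_on_def by blast
  have "\<exists>\<alpha>\<in>A. z \<in> E \<alpha>" if z: "\<alpha> \<in> A" "z \<in> P \<alpha>" for \<alpha> z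
  proof -
    obtain \<beta> where "\<beta> \<in> A" "z \<in> P \<beta>"
      and "\<And>\<gamma>. \<gamma> \<in> A \<and> z \<in> P \<gamma> \<Longrightarrow> to_nat_on A \<beta> \<le> to_nat_on A \<gamma>"
      using ex_has_least_nat[of "\<lambda>\<alpha>. \<alpha> \<in> A \<and> z \<in> P \<alpha>" _ "to_nat_on A"] z by metis
    hence "z \<in> E \<beta>" unfolding E_def by (auto simp: not_less[symmetric])
    with \<open>\<beta> \<in> A\<close> show ?thesis by blast
  qed
  hence 4: "(\<Union>\<alpha>\<in>A. E \<alpha>) = (\<Union>\<alpha>\<in>A. P \<alpha>)"
    by (auto simp: E_def)
  have "E \<alpha> \<subseteq> P \<alpha>" for \<alpha>
    by (auto simp: E_def)
  with 1 2 3 4 show ?thesis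
    by (intro exI[of _ E]) blast
qed

text \<open>The gluing argument without geometry: \<open>P \<alpha>\<close> are the domains,
  \<open>Q \<alpha>\<close> their images, \<open>t \<alpha>\<close> and \<open>h \<alpha>\<close>
  mutually inverse branches. The assumptions are asymmetric on purpose: the domains cover exactly
  and overlap in null sets, while the images only cover almost everywhere; that they overlap in null
  sets is a conclusion.\<close>

locale ae_piecewise_isomorphism = finite_measure M for M :: "'a measure" +
  fixes A :: "'i set" and P Q :: "'i \<Rightarrow> 'a set" and t h :: "'i \<Rightarrow> 'a \<Rightarrow> 'a" and F :: "'a \<Rightarrow> 'a"
  assumes countable: "countable A"
    and P_sets: "\<And>\<alpha>. \<alpha> \<in> A \<Longrightarrow> P \<alpha> \<in> sets M" and Q_sets: "\<And>\<alpha>. \<alpha> \<in> A \<Longrightarrow> Q \<alpha> \<in> sets M"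
    and P_cover: "(\<Union>\<alpha>\<in>A. P \<alpha>) = space M"
    and P_overlap: "\<And>\<alpha> \<beta>. \<alpha> \<in> A \<Longrightarrow> \<beta> \<in> A \<Longrightarrow> \<alpha> \<noteq> \<beta> \<Longrightarrow> P \<alpha> \<inter> P \<beta> \<in> null_sets M"
    and Q_cover: "space M - (\<Union>\<alpha>\<in>A. Q \<alpha>) \<in> null_sets M"
    and t_measurable: "\<And>\<alpha>. \<alpha> \<in> A \<Longrightarrow> t \<alpha> \<in> restrict_space M (P \<alpha>) \<rightarrow>\<^sub>M M"
    and h_measurable: "\<And>\<alpha>. \<alpha> \<in> A \<Longrightarrow> h \<alpha> \<in> restrict_space M (Q \<alpha>) \<rightarrow>\<^sub>M M"
    and t_into: "\<And>\<alpha> z. \<alpha> \<in> A \<Longrightarrow> z \<in> P \<alpha> \<Longrightarrow> t \<alpha> z \<in> Q \<alpha>"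
    and h_into: "\<And>\<alpha> w. \<alpha> \<in> A \<Longrightarrow> w \<in> Q \<alpha> \<Longrightarrow> h \<alpha> w \<in> P \<alpha>"
    and h_t: "\<And>\<alpha> z. \<alpha> \<in> A \<Longrightarrow> z \<in> P \<alpha> \<Longrightarrow> h \<alpha> (t \<alpha> z) = z"
    and t_h: "\<And>\<alpha> w. \<alpha> \<in> A \<Longrightarrow> w \<in> Q \<alpha> \<Longrightarrow> t \<alpha> (h \<alpha> w) = w"
    and preserving: "\<And>\<alpha> B. \<alpha> \<in> A \<Longrightarrow> B \<in> sets M \<Longrightarrow>
      emeasure M (Q \<alpha> \<inter> B) = emeasure M {z \<in> P \<alpha>. t \<alpha> z \<in> B}"
    and glued: "ae_glued M A P t F"
begin

lemma F_measurable [measurable]: "F \<in> M \<rightarrow>\<^sub>M M"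
  using glued by (simp add: ae_glued_def)

lemma F_eq: "\<alpha> \<in> A \<Longrightarrow> AE z in M. z \<in> P \<alpha> \<longrightarrow> F z = t \<alpha> z"
  using glued by (simp add: ae_glued_def)

lemma t_vimage_sets:
  assumes "\<alpha> \<in> A" "B \<in> sets M"
  shows "{z \<in> P \<alpha>. t \<alpha> z \<in> B} \<in> sets M"
proof -
  have "t \<alpha> -` B \<inter> P \<alpha> \<in> sets M"
    using measurable_sets[OF t_measurable assms(2)] P_sets assms sets.sets_into_space[OF P_sets]
    by (simp add: sets_restrict_space_iff space_restrict_space Int_absorb2)
  moreover have "t \<alpha> -` B \<inter> P \<alpha> = {z \<in> P \<alpha>. t \<alpha> z \<in> B}" by auto
  ultimately show ?thesis by simp
qed

lemma h_vimage_sets: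
  assumes "\<alpha> \<in> A" "B \<in> sets M"
  shows "{w \<in> Q \<alpha>. h \<alpha> w \<in> B} \<in> sets M"
proof -
  have "h \<alpha> -` B \<inter> Q \<alpha> \<in> sets M"
    using measurable_sets[OF h_measurable assms(2)] Q_sets assms sets.sets_into_space[OF Q_sets]
    by (simp add: sets_restrict_space_iff space_restrict_space Int_absorb2)
  moreover have "h \<alpha> -` B \<inter> Q \<alpha> = {w \<in> Q \<alpha>. h \<alpha> w \<in> B}" by auto
  ultimately show ?thesis by simp
qed

text \<open>Shrinking \<open>P \<alpha>\<close> to \<open>E \<alpha>\<close> and replacing
  \<open>t \<alpha>\<close> by \<open>F\<close> both change things only on null sets, so
  \<open>preserving\<close> carries over. The images are not shrunk: each \<open>E \<alpha>\<close>
  still accounts for all of \<open>Q \<alpha>\<close>.\<close>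

lemma disjoint_pieces:
  "\<exists>E. (\<forall>\<alpha>\<in>A. E \<alpha> \<in> sets M \<and>
      (\<forall>B\<in>sets M. emeasure M {z \<in> E \<alpha>. F z \<in> B} = emeasure M (Q \<alpha> \<inter> B))) \<and>
    disjoint_family_on E A \<and> (\<Union>\<alpha>\<in>A. E \<alpha>) = space M"
proof -
  obtain E where E': "\<forall>\<alpha>\<in>A. E \<alpha> \<in> sets M \<and> E \<alpha> \<subseteq> P \<alpha> \<and>
      P \<alpha> - E \<alpha> \<subseteq> (\<Union>\<beta>\<in>A - {\<alpha>}. P \<alpha> \<inter> P \<beta>)"
    and disj: "disjoint_family_on E A" and Un: "(\<Union>\<alpha>\<in>A. E \<alpha>) = (\<Union>\<alpha>\<in>A. P \<alpha>)"
    using disjointify_countable[of A P M] countable P_sets by blast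
  have E: "E \<alpha> \<in> sets M" "E \<alpha> \<subseteq> P \<alpha>" "P \<alpha> - E \<alpha> \<subseteq> (\<Union>\<beta>\<in>A - {\<alpha>}. P \<alpha> \<inter> P \<beta>)"
    if "\<alpha> \<in> A" for \<alpha>
    using E' that by auto
  have "emeasure M {z \<in> E \<alpha>. F z \<in> B} = emeasure M (Q \<alpha> \<inter> B)"
    if \<alpha>: "\<alpha> \<in> A" and B: "B \<in> sets M" for \<alpha> B
  proof -
    have "(\<Union>\<beta>\<in>A - {\<alpha>}. P \<alpha> \<inter> P \<beta>) \<in> null_sets M"
      using countable P_overlap \<alpha> by (intro null_sets_UN') auto
    hence "AE z in M. z \<notin> (\<Union>\<beta>\<in>A - {\<alpha>}. P \<alpha> \<inter> P \<beta>)"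
      by (rule AE_not_in)
    hence "AE z in M. z \<in> P \<alpha> \<longrightarrow> z \<in> E \<alpha>"
      by eventually_elim (use E(3)[OF \<alpha>] in blast)
    hence ae: "AE z in M. z \<in> {z \<in> E \<alpha>. F z \<in> B} \<longleftrightarrow> z \<in> {z \<in> P \<alpha>. t \<alpha> z \<in> B}"
      using F_eq[OF \<alpha>] by eventually_elim (use E(2)[OF \<alpha>] in auto)
    have "{z \<in> E \<alpha>. F z \<in> B} = E \<alpha> \<inter> (F -` B \<inter> space M)"
      using sets.sets_into_space[OF E(1)[OF \<alpha>]] by auto
    also have "\<dots> \<in> sets M"
      using E(1)[OF \<alpha>] B by auto
    finally have "emeasure M {z \<in> E \<alpha>. F z \<in> B} = emeasure M {z \<in> P \<alpha>. t \<alpha> z \<in> B}"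
      using t_vimage_sets[OF \<alpha> B] by (intro emeasure_eq_AE ae)
    thus ?thesis
      by (simp add: preserving[OF \<alpha> B])
  qed
  with E(1) disj Un P_cover show ?thesis
    by (intro exI[of _ E]) auto
qed

text \<open>Disjoint parts of the images count almost every point of \<open>B\<close> once, whereas
  the preimage counts it once for each \<open>Q \<alpha>\<close> that contains it.\<close>

lemma emeasure_le_vimage:
  assumes B: "B \<in> sets M"
  shows "emeasure M B \<le> emeasure M (F -` B \<inter> space M)"
proof -
  obtain E where E0: "\<forall>\<alpha>\<in>A. E \<alpha> \<in> sets M \<and>
      (\<forall>B\<in>sets M. emeasure M {z \<in> E \<alpha>. F z \<in> B} = emeasure M (Q \<alpha> \<inter> B))"
    and disj: "disjoint_family_on E A" and Un: "(\<Union>\<alpha>\<in>A. E \<alpha>) = space M"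
    using disjoint_pieces by (elim exE conjE)
  have E: "E \<alpha> \<in> sets M"
    "\<And>B. B \<in> sets M \<Longrightarrow> emeasure M {z \<in> E \<alpha>. F z \<in> B} = emeasure M (Q \<alpha> \<inter> B)"
    if "\<alpha> \<in> A" for \<alpha>
    using E0 that by auto
  obtain E' where E': "\<forall>\<alpha>\<in>A. E' \<alpha> \<in> sets M \<and> E' \<alpha> \<subseteq> Q \<alpha> \<and>
      Q \<alpha> - E' \<alpha> \<subseteq> (\<Union>\<beta>\<in>A - {\<alpha>}. Q \<alpha> \<inter> Q \<beta>)"
    and disj': "disjoint_family_on E' A" and Un': "(\<Union>\<alpha>\<in>A. E' \<alpha>) = (\<Union>\<alpha>\<in>A. Q \<alpha>)"
    using disjointify_countable[of A Q M] countable Q_sets by blast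
  have Q_Un: "(\<Union>\<alpha>\<in>A. Q \<alpha>) \<in> sets M"
    using Q_sets countable by (intro sets.countable_UN'') auto
  have sets: "{z \<in> E \<alpha>. F z \<in> B} \<in> sets M" if "\<alpha> \<in> A" for \<alpha>
  proof -
    have "{z \<in> E \<alpha>. F z \<in> B} = E \<alpha> \<inter> (F -` B \<inter> space M)"
      using sets.sets_into_space[OF E(1)[OF that]] by auto
    thus ?thesis using E(1)[OF that] B by auto
  qed
  have "emeasure M B = emeasure M (B \<inter> (\<Union>\<alpha>\<in>A. Q \<alpha>))"
  proof (rule emeasure_eq_AE)
    show "AE z in M. z \<in> B \<longleftrightarrow> z \<in> B \<inter> (\<Union>\<alpha>\<in>A. Q \<alpha>)"
      using AE_not_in[OF Q_cover] AE_space by eventually_elim auto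
  qed (use B Q_Un in auto)
  also have "B \<inter> (\<Union>\<alpha>\<in>A. Q \<alpha>) = (\<Union>\<alpha>\<in>A. E' \<alpha> \<inter> B)"
    using Un' by auto
  also have "emeasure M \<dots> = (\<integral>\<^sup>+\<alpha>. emeasure M (E' \<alpha> \<inter> B) \<partial>count_space A)"
    using E' disj' B countable
    by (intro emeasure_UN_countable disjoint_family_on_bisimulation[OF disj']) auto
  also have "\<dots> \<le> (\<integral>\<^sup>+\<alpha>. emeasure M {z \<in> E \<alpha>. F z \<in> B} \<partial>count_space A)"
  proof (intro nn_integral_mono)
    fix \<alpha> assume "\<alpha> \<in> space (count_space A)"
    hence \<alpha>: "\<alpha> \<in> A" by simp
    have "emeasure M (E' \<alpha> \<inter> B) \<le> emeasure M (Q \<alpha> \<inter> B)"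
      using E' \<alpha> Q_sets[OF \<alpha>] B by (intro emeasure_mono) auto
    thus "emeasure M (E' \<alpha> \<inter> B) \<le> emeasure M {z \<in> E \<alpha>. F z \<in> B}"
      by (simp add: E(2)[OF \<alpha> B])
  qed
  also have "\<dots> = emeasure M (\<Union>\<alpha>\<in>A. {z \<in> E \<alpha>. F z \<in> B})"
    using disj sets countable
    by (intro emeasure_UN_countable[symmetric]) (auto simp: disjoint_family_on_def)
  also have "(\<Union>\<alpha>\<in>A. {z \<in> E \<alpha>. F z \<in> B}) = F -` B \<inter> space M"
    using Un by auto
  finally show ?thesis .
qed

text \<open>Preimages never lose mass; applied to a set and to its complement, this forces equality
  because the total mass is finite.\<close>

lemma emeasure_vimage:
  assumes B: "B \<in> sets M"
  shows "emeasure M (F -` B \<inter> space M) = emeasure M B"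
proof (rule antisym[OF _ emeasure_le_vimage[OF B]])
  let ?V = "F -` B \<inter> space M"
  have V: "?V \<in> sets M" using B by simp
  have "F -` (space M - B) \<inter> space M = space M - ?V"
    using measurable_space[OF F_measurable] by auto
  hence "emeasure M (space M - B) \<le> emeasure M (space M - ?V)"
    using emeasure_le_vimage[of "space M - B"] B by simp
  hence "measure M (space M - B) \<le> measure M (space M - ?V)"
    by (simp add: emeasure_eq_measure)
  hence "measure M ?V \<le> measure M B"
    using finite_measure_compl[OF B] finite_measure_compl[OF V] by simp
  thus "emeasure M ?V \<le> emeasure M B"
    by (simp add: emeasure_eq_measure)
qed

lemma measure_preserving: "measure_preserving_map M M F"
proof -
  have "distr M M F = M"
    by (rule measure_eqI) (simp_all add: emeasure_distr emeasure_vimage)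
  thus ?thesis
    by (simp add: measure_preserving_map_def)
qed

text \<open>The common part of two images has two disjoint preimages, one in each piece, both of its
  full mass. Together they have at most the mass of the whole preimage, which equals that of the set
  itself; a finite mass that is at least its double vanishes.\<close>

lemma Q_overlap:
  assumes \<alpha>: "\<alpha> \<in> A" and \<beta>: "\<beta> \<in> A" and neq: "\<alpha> \<noteq> \<beta>"
  shows "Q \<alpha> \<inter> Q \<beta> \<in> null_sets M"
proof -
  let ?B = "Q \<alpha> \<inter> Q \<beta>"
  have B: "?B \<in> sets M" using Q_sets \<alpha> \<beta> by auto
  obtain E where E0: "\<forall>\<alpha>\<in>A. E \<alpha> \<in> sets M \<and>
      (\<forall>B\<in>sets M. emeasure M {z \<in> E \<alpha>. F z \<in> B} = emeasure M (Q \<alpha> \<inter> B))"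
    and disj: "disjoint_family_on E A" and Un: "(\<Union>\<alpha>\<in>A. E \<alpha>) = space M"
    using disjoint_pieces by (elim exE conjE)
  have E: "E \<alpha> \<in> sets M"
    "\<And>B. B \<in> sets M \<Longrightarrow> emeasure M {z \<in> E \<alpha>. F z \<in> B} = emeasure M (Q \<alpha> \<inter> B)"
    if "\<alpha> \<in> A" for \<alpha>
    using E0 that by auto
  have V: "F -` ?B \<inter> space M \<in> sets M" by (rule measurable_sets[OF F_measurable B])
  have sub: "E \<gamma> \<subseteq> space M" if "\<gamma> \<in> A" for \<gamma> using E(1)[OF that] by (rule sets.sets_into_space)
  have eq: "{z \<in> E \<gamma>. F z \<in> ?B} = E \<gamma> \<inter> (F -` ?B \<inter> space M)" if "\<gamma> \<in> A" for \<gamma>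
    using sub[OF that] by auto
  have sets: "{z \<in> E \<gamma>. F z \<in> ?B} \<in> sets M" if "\<gamma> \<in> A" for \<gamma>
    unfolding eq[OF that] using E(1)[OF that] V by (rule sets.Int)
  have "emeasure M ?B + emeasure M ?B =
      emeasure M {z \<in> E \<alpha>. F z \<in> ?B} + emeasure M {z \<in> E \<beta>. F z \<in> ?B}"
    using E(2)[OF \<alpha> B] E(2)[OF \<beta> B] by (simp add: Int_absorb Int_left_commute Int_left_absorb Int_commute)
  also have "\<dots> = emeasure M ({z \<in> E \<alpha>. F z \<in> ?B} \<union> {z \<in> E \<beta>. F z \<in> ?B})"
    using disj \<alpha> \<beta> neq by (intro plus_emeasure sets) (auto simp: disjoint_family_on_def)
  also have "\<dots> \<le> emeasure M (F -` ?B \<inter> space M)"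
    using sub \<alpha> \<beta> by (intro emeasure_mono V) auto
  also have "\<dots> = emeasure M ?B"
    by (rule emeasure_vimage[OF B])
  finally have "measure M ?B + measure M ?B \<le> measure M ?B"
    by (simp add: emeasure_eq_measure flip: ennreal_plus)
  hence "measure M ?B = 0"
    using measure_nonneg[of M ?B] by linarith
  thus ?thesis
    using B by (simp add: null_sets_def emeasure_eq_measure)
qed

lemma ae_inverse:
  obtains R where "R \<in> M \<rightarrow>\<^sub>M M" "AE z in M. R (F z) = z" "AE w in M. F (R w) = w"
proof -
  \<comment> \<open>\<open>ae_glued_exists\<close> needs an exact cover, so the index
    \<open>None\<close> adds the null set missed by the images, with the identity as an arbitrary
    value there.\<close>
  define A' where "A' = insert None (Some ` A)"
  define Q' where "Q' \<alpha> = (case \<alpha> of None \<Rightarrow> space M - (\<Union>\<alpha>\<in>A. Q \<alpha>) | Some \<alpha> \<Rightarrow> Q \<alpha>)" for \<alpha>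
  define h' where "h' \<alpha> = (case \<alpha> of None \<Rightarrow> (\<lambda>z. z) | Some \<alpha> \<Rightarrow> h \<alpha>)" for \<alpha>
  have "\<exists>R. ae_glued M A' Q' h' R"
  proof (rule ae_glued_exists)
    show "countable A'" using countable by (simp add: A'_def)
    show "Q' \<alpha> \<in> sets M" if "\<alpha> \<in> A'" for \<alpha>
      using that Q_sets Q_cover by (auto simp: A'_def Q'_def)
    show "(\<Union>\<alpha>\<in>A'. Q' \<alpha>) = space M"
      using sets.sets_into_space[OF Q_sets] by (auto simp: A'_def Q'_def)
    show "Q' \<alpha> \<inter> Q' \<beta> \<in> null_sets M" if "\<alpha> \<in> A'" "\<beta> \<in> A'" "\<alpha> \<noteq> \<beta>" for \<alpha> \<beta>
    proof (cases "\<alpha> = None \<or> \<beta> = None")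
      case True
      hence "Q' \<alpha> \<inter> Q' \<beta> = {}"
        using that by (auto simp: A'_def Q'_def)
      thus ?thesis by simp
    next
      case False
      then obtain a b where ab: "\<alpha> = Some a" "\<beta> = Some b" by auto
      hence "a \<in> A" "b \<in> A" "a \<noteq> b" using that by (auto simp: A'_def)
      from Q_overlap[OF this] show ?thesis by (simp add: ab Q'_def)
    qed
    show "h' \<alpha> \<in> restrict_space M (Q' \<alpha>) \<rightarrow>\<^sub>M M" if "\<alpha> \<in> A'" for \<alpha>
      using that h_measurable by (auto simp: A'_def Q'_def h'_def intro: measurable_restrict_space1)
  qed
  then obtain R where R: "R \<in> M \<rightarrow>\<^sub>M M" and R_eq': "\<forall>\<alpha>\<in>A'. AE z in M. z \<in> Q' \<alpha> \<longrightarrow> R z = h' \<alpha> z"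
    unfolding ae_glued_def by blast
  have R_eq: "AE w in M. w \<in> Q \<alpha> \<longrightarrow> R w = h \<alpha> w" if "\<alpha> \<in> A" for \<alpha>
    using R_eq'[rule_format, of "Some \<alpha>"] that by (simp add: A'_def Q'_def h'_def)
  have RF: "AE z in M. z \<in> P \<alpha> \<longrightarrow> R (F z) = z" if \<alpha>: "\<alpha> \<in> A" for \<alpha>
  proof -
    obtain N where N: "N \<in> null_sets M" "{w \<in> space M. \<not> (w \<in> Q \<alpha> \<longrightarrow> R w = h \<alpha> w)} \<subseteq> N"
      using R_eq[OF \<alpha>] unfolding eventually_ae_filter by blast
    \<comment> \<open>\<open>R\<close> agrees with \<open>h \<alpha>\<close> only off
      \<open>N\<close>, so the points that \<open>t \<alpha>\<close> sends into \<open>N\<close>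
      must be discarded; they form a null set because the branch preserves measure.\<close>
    have "emeasure M {z \<in> P \<alpha>. t \<alpha> z \<in> N} = emeasure M (Q \<alpha> \<inter> N)"
      using preserving[OF \<alpha>, of N] N(1) by auto
    also have "\<dots> \<le> emeasure M N"
      using N(1) by (intro emeasure_mono) auto
    also have "\<dots> = 0" using N(1) by auto
    finally have "{z \<in> P \<alpha>. t \<alpha> z \<in> N} \<in> null_sets M"
      using t_vimage_sets[OF \<alpha>, of N] N(1) by (auto simp: null_sets_def)
    from AE_not_in[OF this] F_eq[OF \<alpha>] AE_space show ?thesis
    proof eventually_elim
      case (elim z)
      show ?case
      proof
        assume z: "z \<in> P \<alpha>"
        have "t \<alpha> z \<in> space M" "t \<alpha> z \<in> Q \<alpha>"
          using t_into[OF \<alpha> z] sets.sets_into_space[OF Q_sets[OF \<alpha>]] by auto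
        thus "R (F z) = z" using elim z N(2) h_t[OF \<alpha> z] by auto
      qed
    qed
  qed
  have FR: "AE w in M. w \<in> Q \<alpha> \<longrightarrow> F (R w) = w" if \<alpha>: "\<alpha> \<in> A" for \<alpha>
  proof -
    obtain N where N: "N \<in> null_sets M" "{z \<in> space M. \<not> (z \<in> P \<alpha> \<longrightarrow> F z = t \<alpha> z)} \<subseteq> N"
      using F_eq[OF \<alpha>] unfolding eventually_ae_filter by blast
    let ?H = "{w \<in> Q \<alpha>. h \<alpha> w \<in> N}"
    have H: "?H \<in> sets M"
      using h_vimage_sets[OF \<alpha>, of N] N(1) by auto
    \<comment> \<open>The same for \<open>h \<alpha>\<close>: pulling \<open>?H\<close> back by
      \<open>t \<alpha>\<close> lands in \<open>N\<close>, since \<open>h \<alpha>\<close> undoes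
      \<open>t \<alpha>\<close>.\<close>
    have "emeasure M ?H = emeasure M (Q \<alpha> \<inter> ?H)"
      by (rule arg_cong[where f = "emeasure M"]) auto
    also have "\<dots> = emeasure M {z \<in> P \<alpha>. t \<alpha> z \<in> ?H}"
      by (rule preserving[OF \<alpha> H])
    also have "\<dots> \<le> emeasure M N"
      using N(1) by (intro emeasure_mono) (auto simp: h_t[OF \<alpha>])
    also have "\<dots> = 0" using N(1) by auto
    finally have "?H \<in> null_sets M"
      using H by (auto simp: null_sets_def)
    from AE_not_in[OF this] R_eq[OF \<alpha>] AE_space show ?thesis
    proof eventually_elim
      case (elim w)
      show ?case
      proof
        assume w: "w \<in> Q \<alpha>"
        have "h \<alpha> w \<in> space M" "h \<alpha> w \<in> P \<alpha>"
          using h_into[OF \<alpha> w] sets.sets_into_space[OF P_sets[OF \<alpha>]] by auto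
        thus "F (R w) = w" using elim w N(2) t_h[OF \<alpha> w] by auto
      qed
    qed
  qed
  show ?thesis
  proof
    show "R \<in> M \<rightarrow>\<^sub>M M" by (rule R)
    have "AE z in M. \<forall>\<alpha>\<in>A. z \<in> P \<alpha> \<longrightarrow> R (F z) = z"
      using RF by (subst AE_ball_countable[OF countable]) blast
    with AE_space show "AE z in M. R (F z) = z"
      by eventually_elim (use P_cover in auto)
    have "AE w in M. \<forall>\<alpha>\<in>A. w \<in> Q \<alpha> \<longrightarrow> F (R w) = w"
      using FR by (subst AE_ball_countable[OF countable]) blast
    with AE_space AE_not_in[OF Q_cover] show "AE w in M. F (R w) = w"
      by eventually_elim auto
  qed
qed

end

section \<open>From almost everywhere statements to an invariant conull set\<close>

lemma AE_funpow_measure_preserving: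
  assumes F: "measure_preserving_map M M F" and Q: "AE z in M. Q z"
  shows "AE z in M. Q ((F ^^ n) z)"
proof (induction n)
  case (Suc n)
  have F': "F \<in> M \<rightarrow>\<^sub>M M" "distr M M F = M"
    using F by (simp_all add: measure_preserving_map_def)
  have "F \<in> M \<rightarrow>\<^sub>M M" "AE z in distr M M F. Q ((F ^^ n) z)"
    unfolding F'(2) by (rule F'(1), rule Suc)
  from AE_distrD[OF this] show ?case
    by (simp add: funpow_swap1)
qed (use Q in simp)

text \<open>Points whose forward orbits under both \<open>F\<close> and \<open>R\<close> stay in a
  good set form a set invariant under both maps, because there \<open>F\<close> and \<open>R\<close>
  cancel. The property \<open>G\<close> is arbitrary, so further almost everywhere conditions can be
  made pointwise at once.\<close>

lemma invariant_conull_set: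
  assumes F: "measure_preserving_map M M F" and R: "R \<in> M \<rightarrow>\<^sub>M M"
    and RF: "AE z in M. R (F z) = z" and FR: "AE z in M. F (R z) = z" and G: "AE z in M. G z"
  obtains X where "X \<in> sets M" "space M - X \<in> null_sets M" "bij_betw F X X"
    "\<And>z. z \<in> X \<Longrightarrow> R z \<in> X" "\<And>z. z \<in> X \<Longrightarrow> the_inv_into X F z = R z" "\<And>z. z \<in> X \<Longrightarrow> G z"
proof -
  have Fm: "F \<in> M \<rightarrow>\<^sub>M M" and FM: "distr M M F = M"
    using F by (simp_all add: measure_preserving_map_def)
  \<comment> \<open>Since \<open>M\<close> is its own push-forward under \<open>F\<close>, pushing
    it by \<open>R\<close> amounts to pushing by \<open>R \<circ> F\<close>, which is the identity
    almost everywhere.\<close>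
  have "distr M M R = distr (distr M M F) M R"
    by (simp add: FM)
  also have "\<dots> = distr M M (R \<circ> F)"
    by (rule distr_distr[OF R Fm])
  also have "\<dots> = distr M M (\<lambda>z. z)"
    using RF Fm R by (intro distr_cong_AE) auto
  also have "\<dots> = M" by (rule distr_id2) simp
  finally have Rmp: "measure_preserving_map M M R"
    using R by (simp add: measure_preserving_map_def)
  have "AE z in M. G z \<and> R (F z) = z \<and> F (R z) = z"
    using G RF FR by eventually_elim auto
  then obtain N where N: "N \<in> null_sets M"
    "{z \<in> space M. \<not> (G z \<and> R (F z) = z \<and> F (R z) = z)} \<subseteq> N"
    unfolding eventually_ae_filter by blast
  let ?G = "space M - N"
  have G': "?G \<in> sets M" "\<And>z. z \<in> ?G \<Longrightarrow> G z \<and> R (F z) = z \<and> F (R z) = z"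
    using N by auto
  have ae: "AE z in M. z \<in> ?G"
    using AE_not_in[OF N(1)] AE_space by eventually_elim auto
  define X where "X = {z \<in> space M. \<forall>n. (F ^^ n) z \<in> ?G \<and> (R ^^ n) z \<in> ?G}"
  have [measurable]: "F ^^ n \<in> M \<rightarrow>\<^sub>M M" "R ^^ n \<in> M \<rightarrow>\<^sub>M M" "?G \<in> sets M" for n
    using Fm R G' by (auto intro: measurable_compose_n)
  have X: "X \<in> sets M" unfolding X_def by measurable
  have "AE z in M. \<forall>n. (F ^^ n) z \<in> ?G \<and> (R ^^ n) z \<in> ?G"
    unfolding AE_all_countable
    using AE_funpow_measure_preserving[OF F ae] AE_funpow_measure_preserving[OF Rmp ae] by auto
  hence "AE z in M. z \<notin> space M - X"
    using AE_space by eventually_elim (auto simp: X_def)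
  hence null: "space M - X \<in> null_sets M"
    using X by (subst (asm) AE_iff_null_sets[symmetric]) auto
  have XG: "z \<in> ?G" if "z \<in> X" for z
    using that unfolding X_def by (auto dest: spec[of _ 0])
  have FX: "F z \<in> X" if z: "z \<in> X" for z
  proof -
    have "(F ^^ n) (F z) \<in> ?G" for n
      using z by (auto simp: X_def dest: spec[of _ "Suc n"] simp flip: funpow_swap1)
    \<comment> \<open>At \<open>n = 0\<close> the point is \<open>F z\<close>, on the forward orbit
      of \<open>z\<close>; otherwise the first \<open>R\<close> cancels \<open>F\<close>.\<close>
    moreover have "(R ^^ n) (F z) \<in> ?G" for n
    proof (cases n)
      case 0
      thus ?thesis using z by (auto simp: X_def dest: spec[of _ 1])
    next
      case (Suc m)
      have "(R ^^ n) (F z) = (R ^^ m) z"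
        using G'(2)[OF XG[OF z]] by (simp add: Suc funpow_swap1)
      thus ?thesis using z by (auto simp: X_def)
    qed
    ultimately show ?thesis
      using measurable_space[OF Fm] z by (auto simp: X_def)
  qed
  have RX: "R z \<in> X" if z: "z \<in> X" for z
  proof -
    have "(R ^^ n) (R z) \<in> ?G" for n
      using z by (auto simp: X_def dest: spec[of _ "Suc n"] simp flip: funpow_swap1)
    moreover have "(F ^^ n) (R z) \<in> ?G" for n
    proof (cases n)
      case 0
      thus ?thesis using z by (auto simp: X_def dest: spec[of _ 1])
    next
      case (Suc m)
      have "(F ^^ n) (R z) = (F ^^ m) z"
        using G'(2)[OF XG[OF z]] by (simp add: Suc funpow_swap1)
      thus ?thesis using z by (auto simp: X_def)
    qed
    ultimately show ?thesis
      using measurable_space[OF R] z by (auto simp: X_def)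
  qed
  have bij: "bij_betw F X X"
    by (rule bij_betw_byWitness[of _ R]) (use FX RX G'(2)[OF XG] in auto)
  have "the_inv_into X F z = R z" if "z \<in> X" for z
    using that RX G'(2)[OF XG] bij by (intro the_inv_into_f_eq) (auto simp: bij_betw_def)
  with X null bij RX G'(2)[OF XG] show ?thesis
    by (intro that[of X]) auto
qed

section \<open>Expanding branches\<close>

text \<open>Expansion forces injectivity, hence invertibility. The lower bound for \<open>B\<close>
  passes to its transpose by duality: for \<open>u\<close> the solution and \<open>v\<close> with
  \<open>B *v v = u\<close>, the square of the norm of \<open>u\<close> is the inner product of
  \<open>w\<close> and \<open>v\<close>, and \<open>v\<close> has norm at most
  \<open>norm u / C\<close>.\<close>

lemma expanding_matrix_inv_transpose:
  fixes B :: "real^'n^'n"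
  assumes C: "C > 0" and exp: "\<And>v. norm (B *v v) \<ge> C * norm v"
  shows "transpose B *v (matrix_inv (transpose B) *v w) = w"
    and "matrix_inv (transpose B) *v (transpose B *v w) = w"
    and "norm (matrix_inv (transpose B) *v w) \<le> norm w / C"
proof -
  have "inj ((*v) B)"
  proof (rule injI)
    fix x y assume "B *v x = B *v y"
    hence "C * norm (x - y) \<le> 0"
      using exp[of "x - y"] by (simp add: matrix_vector_mult_diff_distrib)
    thus "x = y" using C by (simp add: mult_le_0_iff)
  qed
  hence B: "invertible B"
    by (simp add: invertible_left_inverse matrix_left_invertible_injective)
  have matrix_inv: "E ** matrix_inv E = mat 1" "matrix_inv E ** E = mat 1"
    if "invertible E" for E :: "real^'n^'n"
    using someI_ex[of "\<lambda>E'. E ** E' = mat 1 \<and> E' ** E = mat 1"] that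
    by (simp_all add: matrix_inv_def invertible_def)
  note inv = matrix_inv[OF B] matrix_inv[OF transpose_invertible[OF B]]
  show 1: "transpose B *v (matrix_inv (transpose B) *v w) = w"
    by (simp add: matrix_vector_mul_assoc inv del: transpose_matrix_vector)
  show "matrix_inv (transpose B) *v (transpose B *v w) = w"
    by (simp add: matrix_vector_mul_assoc inv del: transpose_matrix_vector)
  let ?u = "matrix_inv (transpose B) *v w" and ?v = "matrix_inv B *v (matrix_inv (transpose B) *v w)"
  have Bv: "B *v ?v = ?u"
    by (simp add: matrix_vector_mul_assoc inv matrix_mul_assoc)
  have "norm ?u * norm ?u = ?u \<bullet> (B *v ?v)"
    by (simp add: Bv dot_square_norm power2_eq_square)
  also have "\<dots> = (transpose B *v ?u) \<bullet> ?v"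
    by (simp add: dot_lmul_matrix)
  also have "\<dots> = w \<bullet> ?v"
    by (simp only: 1)
  also have "\<dots> \<le> norm w * norm ?v"
    by (rule norm_cauchy_schwarz)
  also have "\<dots> \<le> norm w * (norm ?u / C)"
    using exp[of ?v] C unfolding Bv by (intro mult_left_mono) (auto simp: field_simps)
  finally have le: "norm ?u * norm ?u \<le> norm w / C * norm ?u" by simp
  show "norm ?u \<le> norm w / C"
  proof (cases "?u = 0")
    case False
    show ?thesis by (rule mult_right_le_imp_le[OF le]) (use False in simp)
  qed (use C in simp)
qed

text \<open>\<open>T\<close> agrees with the ambient diffeomorphism only on \<open>D\<close>, so its
  derivative is available only within \<open>D\<close>.\<close>

lemma diffeo_on_compactD:
  assumes "diffeo_on_compact D T DT"
  shows "\<And>x. x \<in> D \<Longrightarrow> (T has_derivative (*v) (DT x)) (at x within D)"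
    and "inj_on T D" and "continuous_on D DT"
proof -
  obtain U V g G h where D: "D \<subseteq> U" and g: "C1_on U g G" and h: "homeomorphism U V g h"
    and eq: "\<And>x. x \<in> D \<Longrightarrow> T x = g x \<and> DT x = G x"
    using assms unfolding diffeo_on_compact_def C1_diffeo_def by blast
  show "(T has_derivative (*v) (DT x)) (at x within D)" if x: "x \<in> D" for x
  proof (rule has_derivative_transform)
    have "(g has_derivative (*v) (G x)) (at x)"
      using g D x unfolding C1_on_def by blast
    thus "(g has_derivative (*v) (DT x)) (at x within D)"
      using eq[OF x] by (auto intro: has_derivative_at_withinI)
  qed (use x eq in auto)
  have "inj_on g U"
    using h by (auto simp: homeomorphism_def intro: inj_on_inverseI)
  hence "inj_on g D" using D by (rule inj_on_subset)
  thus "inj_on T D" using eq by (auto simp: inj_on_def)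
  have "continuous_on D G"
    using g D unfolding C1_on_def by (blast intro: continuous_on_subset)
  thus "continuous_on D DT"
    using eq by (auto cong: continuous_on_cong)
qed

locale expanding_branch =
  fixes D :: "'i \<Rightarrow> (real^'n) set" and T :: "'i \<Rightarrow> real^'n \<Rightarrow> real^'n"
    and DT :: "'i \<Rightarrow> real^'n \<Rightarrow> real^'n^'n" and C :: real
    and S :: "'i \<Rightarrow> (real^'n) \<times> (real^'n) \<Rightarrow> real^'n" and f :: "'i \<Rightarrow> real^'n \<Rightarrow> real^'n"
    and \<alpha> :: 'i
  assumes D: "compact (D \<alpha>)"
    and diffeo: "diffeo_on_compact (D \<alpha>) (T \<alpha>) (DT \<alpha>)"
    and C: "C > 0" and expanding: "\<And>x v. x \<in> D \<alpha> \<Longrightarrow> norm (DT \<alpha> x *v v) \<ge> C * norm v"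
    and S: "continuous_on (D \<alpha> \<times> UNIV) (S \<alpha>)"
    and S_eq: "\<And>x y. x \<in> D \<alpha> \<Longrightarrow> S \<alpha> (x, y) = matrix_inv (transpose (DT \<alpha> x)) *v y + f \<alpha> x"
begin

lemma continuous_branch: "continuous_on (D \<alpha> \<times> UNIV) (fibre_branch T S \<alpha>)"
proof -
  have "continuous_on (D \<alpha>) (T \<alpha>)"
    using diffeo_on_compactD(1)[OF diffeo] by (rule has_derivative_continuous_on)
  hence "continuous_on (D \<alpha> \<times> UNIV) (\<lambda>z. T \<alpha> (fst z))"
    by (rule continuous_on_compose2) (auto intro: continuous_intros)
  thus ?thesis
    unfolding fibre_branch_def by (intro continuous_on_Pair S)
qed

lemma inj_branch: "inj_on (fibre_branch T S \<alpha>) (D \<alpha> \<times> UNIV)"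
proof (rule inj_onI, clarify)
  fix x y x' y' assume x: "x \<in> D \<alpha>" "x' \<in> D \<alpha>"
    and eq: "fibre_branch T S \<alpha> (x, y) = fibre_branch T S \<alpha> (x', y')"
  have "x = x'"
    using eq x inj_onD[OF diffeo_on_compactD(2)[OF diffeo]] by (simp add: fibre_branch_def)
  moreover have "transpose (DT \<alpha> x) *v (matrix_inv (transpose (DT \<alpha> x)) *v y) =
      transpose (DT \<alpha> x) *v (matrix_inv (transpose (DT \<alpha> x)) *v y')"
    using eq x \<open>x = x'\<close> by (simp add: fibre_branch_def S_eq)
  ultimately show "x = x' \<and> y = y'"
    unfolding expanding_matrix_inv_transpose(1)[OF C expanding[OF x(1)]] by (rule conjI)
qed

text \<open>The offset \<open>f \<alpha> x\<close> depends on the base point alone and cancels in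
  the difference.\<close>

lemma fibre_contraction:
  assumes "x \<in> D \<alpha>"
  shows "dist (S \<alpha> (x, y)) (S \<alpha> (x, y')) \<le> dist y y' / C"
  using expanding_matrix_inv_transpose(3)[OF C expanding[OF assms], of "y - y'"] assms
  by (simp add: S_eq dist_norm matrix_vector_mult_diff_distrib)

lemma compact_over: "compact K \<Longrightarrow> compact (over K (D \<alpha>))"
proof -
  assume K: "compact K"
  have "over K (D \<alpha>) = K \<inter> D \<alpha> \<times> UNIV" by (auto simp: over_def)
  thus ?thesis
    using K compact_imp_closed[OF D] by (auto intro!: compact_Int_closed closed_Times)
qed

lemma emeasure_branch:
  assumes K: "compact K" and B: "B \<in> sets borel"
  shows "emeasure lborel (fibre_branch T S \<alpha> ` over K (D \<alpha>) \<inter> B) =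
    emeasure lborel {z \<in> over K (D \<alpha>). fibre_branch T S \<alpha> z \<in> B}"
proof -
  let ?Q = "fibre_branch T S \<alpha> ` over K (D \<alpha>)"
  have sub: "over K (D \<alpha>) \<subseteq> D \<alpha> \<times> UNIV"
    by (auto simp: over_def)
  have Q: "compact ?Q"
    using continuous_on_subset[OF continuous_branch sub] compact_over[OF K]
    by (rule compact_continuous_image)
  have QB: "?Q \<inter> B \<in> sets borel" "bounded (?Q \<inter> B)"
    using Q B compact_imp_bounded[OF Q] by (auto simp: borel_compact)
  have cont: "continuous_on (D \<alpha>) (\<lambda>x. DT \<alpha> x *v v)" for v
    using diffeo_on_compactD(3)[OF diffeo]
    by (simp add: matrix_vector_mult_def continuous_on_vec_lambda) (intro continuous_intros)
  \<comment> \<open>Taking \<open>?Q \<inter> B\<close> as target encodes the restriction to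
    \<open>K\<close>: the branch is injective on all of \<open>D \<alpha> \<times> UNIV\<close>, so
    a point lands in \<open>?Q\<close> exactly when it lies in \<open>over K (D \<alpha>)\<close>.
    Compactness of \<open>?Q\<close> also supplies the required boundedness.\<close>
  have "emeasure lborel (?Q \<inter> B \<inter> T \<alpha> ` D \<alpha> \<times> UNIV) =
      emeasure lborel {z \<in> D \<alpha> \<times> UNIV. (T \<alpha> (fst z), S \<alpha> z) \<in> ?Q \<inter> B}"
    by (rule emeasure_skew_product[where L = "\<lambda>x. (*v) (DT \<alpha> x)" and f = "f \<alpha>"
        and M = "\<lambda>x. (*v) (matrix_inv (transpose (DT \<alpha> x)))",
        OF D diffeo_on_compactD(1,2)[OF diffeo] cont S S_eq _ _ QB])
       (simp_all add: adjoint_matrix expanding_matrix_inv_transpose(1,2)[OF C expanding]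
        del: transpose_matrix_vector)
  also have "?Q \<inter> B \<inter> T \<alpha> ` D \<alpha> \<times> UNIV = ?Q \<inter> B"
    by (auto simp: fibre_branch_def over_def)
  also have "{z \<in> D \<alpha> \<times> UNIV. (T \<alpha> (fst z), S \<alpha> z) \<in> ?Q \<inter> B} =
      {z \<in> over K (D \<alpha>). fibre_branch T S \<alpha> z \<in> B}"
    using inj_on_image_mem_iff[OF inj_branch _ sub] sub
    by (auto simp: fibre_branch_def)
  finally show ?thesis .
qed

end

section \<open>Measure theory on \<open>K\<close> and separation of points by their past\<close>

lemma measurable_continuous_restrict_lborel:
  fixes g :: "'a::euclidean_space \<Rightarrow> 'a"
  assumes "continuous_on P g" "P \<subseteq> K" "g ` P \<subseteq> K" "P \<in> sets borel" "K \<in> sets borel"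
  shows "g \<in> restrict_space (restrict_space lborel K) P \<rightarrow>\<^sub>M restrict_space lborel K"
proof -
  have "restrict_space (restrict_space lborel K) P = restrict_space lborel P"
    using assms by (subst restrict_restrict_space) (auto simp: Int_absorb1)
  moreover have "g \<in> restrict_space lborel P \<rightarrow>\<^sub>M lborel"
    using borel_measurable_continuous_on_restrict[OF assms(1)]
    by (simp cong: measurable_cong_sets sets_restrict_space_cong)
  ultimately show ?thesis
    using assms by (auto intro!: measurable_restrict_space2 simp: space_restrict_space)
qed

text \<open>Points are separated by their base coordinates at times \<open>0, -1, -2, ...\<close>;
  at \<open>k = 0\<close> both sides are the identity.\<close>

lemma int_iterate_minus_of_nat:
  "int_iterate X F (- int k) = the_inv_into X F ^^ k"
  by (cases "k = 0") (auto simp: int_iterate_def)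

theorem theorem2:
  fixes I :: "(real^'n) set"
    and A :: "'i set"
    and D :: "'i \<Rightarrow> (real^'n) set"
    and T :: "'i \<Rightarrow> real^'n \<Rightarrow> real^'n"
    and DT :: "'i \<Rightarrow> real^'n \<Rightarrow> real^'n^'n"
    and C :: real
    and S :: "'i \<Rightarrow> (real^'n) \<times> (real^'n) \<Rightarrow> real^'n"
    and f :: "'i \<Rightarrow> real^'n \<Rightarrow> real^'n"
    and K :: "((real^'n) \<times> (real^'n)) set"
    and T0 :: "real^'n \<Rightarrow> real^'n"
    and Tt :: "(real^'n) \<times> (real^'n) \<Rightarrow> (real^'n) \<times> (real^'n)"
  assumes "I \<noteq> {}" and "compact I" and "regular_closed I"
    and "countable A" and "(\<Union>\<alpha>\<in>A. D \<alpha>) = I"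
    and "\<And>\<alpha>. \<alpha> \<in> A \<Longrightarrow> compact (D \<alpha>) \<and> regular_closed (D \<alpha>)"
    and "\<And>\<alpha> \<beta>. \<alpha> \<in> A \<Longrightarrow> \<beta> \<in> A \<Longrightarrow> \<alpha> \<noteq> \<beta> \<Longrightarrow> emeasure lborel (D \<alpha> \<inter> D \<beta>) = 0"
    and "\<And>\<alpha>. \<alpha> \<in> A \<Longrightarrow> diffeo_on_compact (D \<alpha>) (T \<alpha>) (DT \<alpha>)"
    and "(\<Union>\<alpha>\<in>A. T \<alpha> ` D \<alpha>) = I"
    and "C > 1"
    and "\<And>\<alpha> x v. \<alpha> \<in> A \<Longrightarrow> x \<in> D \<alpha> \<Longrightarrow> norm (DT \<alpha> x *v v) \<ge> C * norm v"
    and "\<And>\<alpha>. \<alpha> \<in> A \<Longrightarrow> continuous_on (D \<alpha> \<times> UNIV) (S \<alpha>)"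
    and "\<And>\<alpha> x y. \<alpha> \<in> A \<Longrightarrow> x \<in> D \<alpha> \<Longrightarrow>
           S \<alpha> (x, y) = matrix_inv (transpose (DT \<alpha> x)) *v y + f \<alpha> x"
    and "\<And>\<alpha>. \<alpha> \<in> A \<Longrightarrow> piecewise_continuous_on (D \<alpha>) (f \<alpha>)"
    and "\<exists>b. \<forall>\<alpha>\<in>A. \<forall>x\<in>D \<alpha>. norm (f \<alpha> x) \<le> b"
    and "unique_fixed_point_among (compact_projecting_onto I) (Theta A D T S) K"
    and "ae_glued (marginal I K) A D T T0"
    and "ae_glued (restrict_space lborel K) A (\<lambda>\<alpha>. over K (D \<alpha>)) (fibre_branch T S) Tt"
    and "emeasure lborel K \<noteq> 0"
    and "emeasure lborel (K - ext_image A D T S K) = 0"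
  shows "natural_extension_model (restrict_space lborel K) Tt fst (marginal I K) T0"
proof -
  note countable = assms(4) and D_cover = assms(5) and D = assms(6)
    and D_overlap = assms(7) and diffeo = assms(8) and C = assms(10) and expanding = assms(11)
    and S_cont = assms(12) and S_eq = assms(13) and fixed = assms(16)
    and T0 = assms(17) and Tt = assms(18) and K_conull = assms(20)
  let ?M = "restrict_space lborel K" and ?N = "marginal I K"
  let ?t = "fibre_branch T S" and ?P = "\<lambda>\<alpha>. over K (D \<alpha>)"
  have K: "compact K" "fst ` K = I" "Theta A D T S K = K"
    using fixed by (auto simp: unique_fixed_point_among_def compact_projecting_onto_def)
  have K_borel: "K \<in> sets borel" using K(1) by (rule borel_compact)
  have sets_M: "X \<in> sets ?M \<longleftrightarrow> X \<subseteq> K \<and> X \<in> sets borel" for X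
    using K_borel by (subst sets_restrict_space_iff) auto
  have space_M: "space ?M = K" by (simp add: space_restrict_space)
  have emeasure_M: "emeasure ?M X = emeasure lborel X" if "X \<subseteq> K" for X
    using K_borel that by (intro emeasure_restrict_space) auto
  have branch: "expanding_branch D T DT C S f \<alpha>" if "\<alpha> \<in> A" for \<alpha>
    using that D diffeo C expanding S_cont S_eq by unfold_locales auto
  have P_sub: "?P \<alpha> \<subseteq> K" "?P \<alpha> \<subseteq> D \<alpha> \<times> UNIV" for \<alpha>
    by (auto simp: over_def)
  have cpt_P: "compact (?P \<alpha>)" if "\<alpha> \<in> A" for \<alpha>
    using expanding_branch.compact_over[OF branch[OF that] K(1)] .
  have cont_t: "continuous_on (?P \<alpha>) (?t \<alpha>)" if "\<alpha> \<in> A" for \<alpha>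
    using expanding_branch.continuous_branch[OF branch[OF that]] P_sub(2) by (rule continuous_on_subset)
  have inj_t: "inj_on (?t \<alpha>) (?P \<alpha>)" if "\<alpha> \<in> A" for \<alpha>
    using expanding_branch.inj_branch[OF branch[OF that]] P_sub(2) by (rule inj_on_subset)
  have cpt_Q: "compact (?t \<alpha> ` ?P \<alpha>)" if "\<alpha> \<in> A" for \<alpha>
    using that by (intro compact_continuous_image cont_t cpt_P)
  \<comment> \<open>\<open>K\<close> is the closure of its image, so every branch maps its part of
    \<open>K\<close> into \<open>K\<close>.\<close>
  have ext_sub: "ext_image A D T S K \<subseteq> K"
    using K(3) closure_subset unfolding Theta_def by metis
  have Q_sub: "?t \<alpha> ` ?P \<alpha> \<subseteq> K" if "\<alpha> \<in> A" for \<alpha>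
    using ext_sub that unfolding ext_image_def by auto
  have t_h: "?t \<alpha> (the_inv_into (?P \<alpha>) (?t \<alpha>) w) = w" if "\<alpha> \<in> A" "w \<in> ?t \<alpha> ` ?P \<alpha>" for \<alpha> w
    using that by (intro f_the_inv_into_f inj_t)
  have h_into: "the_inv_into (?P \<alpha>) (?t \<alpha>) w \<in> ?P \<alpha>" if "\<alpha> \<in> A" "w \<in> ?t \<alpha> ` ?P \<alpha>" for \<alpha> w
    using that by (intro the_inv_into_into inj_t) auto
  interpret ae_piecewise_isomorphism ?M A ?P "\<lambda>\<alpha>. ?t \<alpha> ` ?P \<alpha>" ?t
    "\<lambda>\<alpha>. the_inv_into (?P \<alpha>) (?t \<alpha>)" Tt
  proof (intro ae_piecewise_isomorphism.intro ae_piecewise_isomorphism_axioms.intro)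
    show "finite_measure ?M"
      using emeasure_bounded_finite[OF compact_imp_bounded[OF K(1)]]
      by (intro finite_measureI) (simp add: space_M emeasure_M)
    show "?P \<alpha> \<in> sets ?M" if "\<alpha> \<in> A" for \<alpha>
      using P_sub cpt_P[OF that] by (auto simp: sets_M borel_compact)
    show "?t \<alpha> ` ?P \<alpha> \<in> sets ?M" if "\<alpha> \<in> A" for \<alpha>
      using Q_sub[OF that] cpt_Q[OF that] by (simp add: sets_M borel_compact)
    show "(\<Union>\<alpha>\<in>A. ?P \<alpha>) = space ?M"
      using K(2) D_cover by (auto simp: space_M over_def)
    show "?P \<alpha> \<inter> ?P \<beta> \<in> null_sets ?M" if "\<alpha> \<in> A" "\<beta> \<in> A" "\<alpha> \<noteq> \<beta>" for \<alpha> \<beta>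
    proof -
      let ?O = "D \<alpha> \<inter> D \<beta>"
      have O: "?O \<in> sets borel"
        using D that by (intro sets.Int borel_compact) auto
      have "emeasure lborel (?O \<times> (UNIV :: (real^'n) set)) =
          emeasure (lborel \<Otimes>\<^sub>M lborel) (?O \<times> (UNIV :: (real^'n) set))"
        by (simp add: lborel_prod)
      \<comment> \<open>The second factor is infinite, but zero times infinity is zero in
        \<open>ennreal\<close>.\<close>
      also have "\<dots> = emeasure lborel ?O * emeasure lborel (UNIV :: (real^'n) set)"
        using O by (intro lborel.emeasure_pair_measure_Times) auto
      also have "\<dots> = 0"
        using D_overlap[OF that] by simp
      finally have null: "emeasure lborel (?O \<times> (UNIV :: (real^'n) set)) = 0" .
      have "closed ?O"
        using D that by (intro closed_Int compact_imp_closed) auto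
      hence "?O \<times> (UNIV :: (real^'n) set) \<in> sets borel"
        by (intro borel_closed closed_Times closed_UNIV)
      hence "emeasure lborel (?P \<alpha> \<inter> ?P \<beta>) \<le> emeasure lborel (?O \<times> (UNIV :: (real^'n) set))"
        by (intro emeasure_mono) (auto simp: over_def)
      hence "emeasure ?M (?P \<alpha> \<inter> ?P \<beta>) = 0"
        using P_sub by (subst emeasure_M) (auto simp: null)
      thus ?thesis
        using cpt_P that P_sub by (auto simp: null_sets_def sets_M intro!: borel_compact sets.Int)
    qed
    have "(\<Union>\<alpha>\<in>A. ?t \<alpha> ` ?P \<alpha>) \<in> sets borel"
      using cpt_Q countable by (intro sets.countable_UN'') (auto intro: borel_compact)
    thus "space ?M - (\<Union>\<alpha>\<in>A. ?t \<alpha> ` ?P \<alpha>) \<in> null_sets ?M"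
      using K_conull K_borel by (auto simp: null_sets_def sets_M space_M emeasure_M ext_image_def)
    show "?t \<alpha> \<in> restrict_space ?M (?P \<alpha>) \<rightarrow>\<^sub>M ?M" if "\<alpha> \<in> A" for \<alpha>
      using that by (intro measurable_continuous_restrict_lborel cont_t P_sub Q_sub K_borel
          borel_compact cpt_P)
    show "the_inv_into (?P \<alpha>) (?t \<alpha>) \<in> restrict_space ?M (?t \<alpha> ` ?P \<alpha>) \<rightarrow>\<^sub>M ?M"
      if "\<alpha> \<in> A" for \<alpha>
    proof (rule measurable_continuous_restrict_lborel)
      show "continuous_on (?t \<alpha> ` ?P \<alpha>) (the_inv_into (?P \<alpha>) (?t \<alpha>))"
        using that by (intro continuous_on_inv_into cont_t cpt_P inj_t)
      show "the_inv_into (?P \<alpha>) (?t \<alpha>) ` ?t \<alpha> ` ?P \<alpha> \<subseteq> K"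
        using h_into[OF that] P_sub(1) by blast
    qed (use that Q_sub cpt_Q K_borel in \<open>auto intro: borel_compact\<close>)
    show "emeasure ?M (?t \<alpha> ` ?P \<alpha> \<inter> B) = emeasure ?M {z \<in> ?P \<alpha>. ?t \<alpha> z \<in> B}"
      if \<alpha>: "\<alpha> \<in> A" and B: "B \<in> sets ?M" for \<alpha> B
    proof -
      have "emeasure lborel (?t \<alpha> ` ?P \<alpha> \<inter> B) = emeasure lborel {z \<in> ?P \<alpha>. ?t \<alpha> z \<in> B}"
        using B by (intro expanding_branch.emeasure_branch[OF branch[OF \<alpha>] K(1)]) (simp add: sets_M)
      thus ?thesis
        using Q_sub[OF \<alpha>] P_sub(1) by (subst (1 2) emeasure_M) auto
    qed
  qed (use countable Tt t_h h_into inj_t in \<open>auto simp: the_inv_into_f_f\<close>)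
  have fst_N0: "fst \<in> ?M \<rightarrow>\<^sub>M restrict_space borel I"
  proof (rule measurable_restrict_space2)
    show "fst \<in> space ?M \<rightarrow> I" using K(2) by (auto simp: space_M)
    show "fst \<in> borel_measurable ?M"
      by (intro measurable_restrict_space1) (simp add: borel_measurable_continuous_onI continuous_on_fst)
  qed
  have sets_N: "sets ?N = sets (restrict_space borel I)"
    by (simp add: marginal_def)
  have fst_N: "fst \<in> ?M \<rightarrow>\<^sub>M ?N"
    using fst_N0 by (simp cong: measurable_cong_sets add: sets_N)
  have distr_fst: "distr ?M ?N fst = ?N"
    unfolding marginal_def by (rule distr_cong) auto
  have T0_meas: "T0 \<in> ?N \<rightarrow>\<^sub>M ?N"
    and T0_eq: "\<And>\<alpha>. \<alpha> \<in> A \<Longrightarrow> AE x in ?N. x \<in> D \<alpha> \<longrightarrow> T0 x = T \<alpha> x"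
    using T0 by (auto simp: ae_glued_def)
  have Tt_eq: "AE z in ?M. \<forall>\<alpha>\<in>A. z \<in> ?P \<alpha> \<longrightarrow> Tt z = ?t \<alpha> z"
    using F_eq by (subst AE_ball_countable[OF countable]) blast
  \<comment> \<open>The exceptional sets of \<open>T0\<close> are null for the marginal, so their
    preimages under \<open>fst\<close> are null in \<open>K\<close>.\<close>
  have "AE z in ?M. \<forall>\<alpha>\<in>A. fst z \<in> D \<alpha> \<longrightarrow> T0 (fst z) = T \<alpha> (fst z)"
  proof (subst AE_ball_countable[OF countable], rule ballI)
    fix \<alpha> assume \<alpha>: "\<alpha> \<in> A"
    have "AE x in distr ?M ?N fst. x \<in> D \<alpha> \<longrightarrow> T0 x = T \<alpha> x"
      unfolding distr_fst by (rule T0_eq[OF \<alpha>])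
    from AE_distrD[OF fst_N this]
    show "AE z in ?M. fst z \<in> D \<alpha> \<longrightarrow> T0 (fst z) = T \<alpha> (fst z)" .
  qed
  with Tt_eq AE_space have semiconj: "AE z in ?M. fst (Tt z) = T0 (fst z)"
  proof eventually_elim
    case (elim z)
    obtain \<alpha> where "\<alpha> \<in> A" "z \<in> ?P \<alpha>"
      using elim P_cover by blast
    thus ?case using elim by (auto simp: fibre_branch_def over_def)
  qed
  have Tt_meas: "Tt \<in> ?M \<rightarrow>\<^sub>M ?M" and Tt_distr: "distr ?M ?M Tt = ?M"
    using measure_preserving by (simp_all add: measure_preserving_map_def)
  \<comment> \<open>A factor of a measure-preserving map preserves the image measure.\<close>
  have "distr ?N ?N T0 = distr (distr ?M ?N fst) ?N T0"
    by (simp only: distr_fst)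
  also have "\<dots> = distr ?M ?N (T0 \<circ> fst)"
    by (rule distr_distr[OF T0_meas fst_N])
  also have "\<dots> = distr ?M ?N (fst \<circ> Tt)"
    using semiconj fst_N T0_meas Tt_meas by (intro distr_cong_AE) auto
  also have "\<dots> = distr (distr ?M ?M Tt) ?N fst"
    by (rule distr_distr[OF fst_N Tt_meas, symmetric])
  also have "\<dots> = ?N"
    by (simp only: Tt_distr distr_fst)
  finally have T0_preserving: "measure_preserving_map ?N ?N T0"
    using T0_meas by (simp add: measure_preserving_map_def)
  have "AE z in ?M. \<forall>\<alpha>\<in>A. \<forall>\<beta>\<in>A. \<alpha> \<noteq> \<beta> \<longrightarrow> z \<notin> ?P \<alpha> \<inter> ?P \<beta>"
  proof (unfold AE_ball_countable[OF countable], intro ballI)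
    show "AE z in ?M. \<alpha> \<noteq> \<beta> \<longrightarrow> z \<notin> ?P \<alpha> \<inter> ?P \<beta>" if "\<alpha> \<in> A" "\<beta> \<in> A" for \<alpha> \<beta>
      using AE_not_in[OF P_overlap[OF that]] by (cases "\<alpha> = \<beta>") auto
  qed
  with Tt_eq have good: "AE z in ?M. (\<forall>\<alpha>\<in>A. z \<in> ?P \<alpha> \<longrightarrow> Tt z = ?t \<alpha> z) \<and>
      (\<forall>\<alpha>\<in>A. \<forall>\<beta>\<in>A. \<alpha> \<noteq> \<beta> \<longrightarrow> z \<notin> ?P \<alpha> \<inter> ?P \<beta>)"
    by eventually_elim blast
  obtain R where R: "R \<in> ?M \<rightarrow>\<^sub>M ?M" "AE z in ?M. R (Tt z) = z" "AE w in ?M. Tt (R w) = w"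
    by (rule ae_inverse)
  obtain X where X: "X \<in> sets ?M" "space ?M - X \<in> null_sets ?M" "bij_betw Tt X X"
    and R_into: "\<And>z. z \<in> X \<Longrightarrow> R z \<in> X" and inv_eq: "\<And>z. z \<in> X \<Longrightarrow> the_inv_into X Tt z = R z"
    and X_good: "\<And>z. z \<in> X \<Longrightarrow> (\<forall>\<alpha>\<in>A. z \<in> ?P \<alpha> \<longrightarrow> Tt z = ?t \<alpha> z) \<and>
      (\<forall>\<alpha>\<in>A. \<forall>\<beta>\<in>A. \<alpha> \<noteq> \<beta> \<longrightarrow> z \<notin> ?P \<alpha> \<inter> ?P \<beta>)"
    using invariant_conull_set[OF measure_preserving R good] by metis
  have "R \<in> restrict_space ?M X \<rightarrow>\<^sub>M restrict_space ?M X"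
    by (rule measurable_restrict_space3[OF R(1)]) (use R_into in blast)
  hence inv_meas: "the_inv_into X Tt \<in> restrict_space ?M X \<rightarrow>\<^sub>M restrict_space ?M X"
    by (subst measurable_cong[of _ _ R]) (auto simp: inv_eq space_restrict_space)
  have XK: "X \<subseteq> K" using X(1) by (simp add: sets_M)
  have "inj_on (\<lambda>z n. fst (int_iterate X Tt n z)) X"
  proof (rule inj_onI)
    fix z z' assume z: "z \<in> X" and z': "z' \<in> X"
      and eq: "(\<lambda>n. fst (int_iterate X Tt n z)) = (\<lambda>n. fst (int_iterate X Tt n z'))"
    let ?G = "the_inv_into X Tt"
    \<comment> \<open>The two pasts: \<open>w k\<close> and \<open>w' k\<close> lie \<open>k\<close>
      steps before \<open>z\<close> and \<open>z'\<close>.\<close>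
    define w where "w k = (?G ^^ k) z" for k
    define w' where "w' k = (?G ^^ k) z'" for k
    have G_X: "?G v \<in> X" if "v \<in> X" for v
      using that by (simp add: inv_eq R_into)
    have w_X: "w k \<in> X" and w'_X: "w' k \<in> X" for k
      by (induction k) (auto simp: w_def w'_def z z' G_X)
    have fst_eq: "fst (w k) = fst (w' k)" for k
      using fun_cong[OF eq, of "- int k"] by (simp add: int_iterate_minus_of_nat w_def w'_def)
    have Tt_w: "Tt (w (Suc k)) = w k" "Tt (w' (Suc k)) = w' k" for k
      using w_X[of k] w'_X[of k] X(3)
      by (auto simp: w_def w'_def bij_betw_def intro!: f_the_inv_into_f)
    \<comment> \<open>Membership in \<open>?P \<alpha>\<close> of a point of \<open>K\<close>
      depends only on its base point, so the two pasts pass through the same branch at every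
      step.\<close>
    have step: "dist (snd (w k)) (snd (w' k)) \<le> dist (snd (w (Suc k))) (snd (w' (Suc k))) / C" for k
    proof -
      obtain \<alpha> where \<alpha>: "\<alpha> \<in> A" "w (Suc k) \<in> ?P \<alpha>"
        using w_X[of "Suc k"] XK P_cover space_M by blast
      hence \<alpha>': "w' (Suc k) \<in> ?P \<alpha>"
        using w'_X[of "Suc k"] XK fst_eq[of "Suc k"] by (auto simp: over_def)
      have "w k = ?t \<alpha> (w (Suc k))" "w' k = ?t \<alpha> (w' (Suc k))"
        using X_good w_X w'_X \<alpha> \<alpha>' by (metis Tt_w)+
      hence "snd (w k) = S \<alpha> (fst (w (Suc k)), snd (w (Suc k)))"
        "snd (w' k) = S \<alpha> (fst (w (Suc k)), snd (w' (Suc k)))"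
        by (simp_all add: fibre_branch_def prod_eq_iff fst_eq[of "Suc k"])
          (simp add: fst_eq[of "Suc k", symmetric])
      thus ?thesis
        using expanding_branch.fibre_contraction[OF branch[OF \<alpha>(1)], of "fst (w (Suc k))"
            "snd (w (Suc k))" "snd (w' (Suc k))"] \<alpha>(2)
        by (simp add: over_def)
    qed
    have le: "dist (snd z) (snd z') \<le> dist (snd (w k)) (snd (w' k)) / C ^ k" for k
    proof (induction k)
      case (Suc k)
      have "dist (snd (w k)) (snd (w' k)) / C ^ k \<le>
          dist (snd (w (Suc k))) (snd (w' (Suc k))) / C / C ^ k"
        using step[of k] C by (intro divide_right_mono) auto
      with Suc show ?case by (simp add: mult.commute)
    qed (simp add: w_def w'_def)
    \<comment> \<open>\<open>b\<close> bounds the fibre distance uniformly along both pasts;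
      \<open>C > 1\<close> then sends \<open>b / C ^ k\<close> to 0.\<close>
    obtain b where b: "\<And>v v'. v \<in> snd ` K \<Longrightarrow> v' \<in> snd ` K \<Longrightarrow> dist v v' \<le> b"
      using bounded_two_points[THEN iffD1, OF bounded_snd[OF compact_imp_bounded[OF K(1)]]] by blast
    have "dist (snd z) (snd z') \<le> b / C ^ k" for k
    proof -
      have "dist (snd (w k)) (snd (w' k)) \<le> b"
        using w_X[of k] w'_X[of k] XK by (intro b) auto
      hence "dist (snd (w k)) (snd (w' k)) / C ^ k \<le> b / C ^ k"
        using C by (intro divide_right_mono) auto
      with le[of k] show ?thesis by simp
    qed
    moreover have "(\<lambda>k. b / C ^ k) \<longlonglongrightarrow> 0"
      using C by (rule LIMSEQ_divide_realpow_zero)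
    ultimately have "dist (snd z) (snd z') \<le> 0"
      by (intro LIMSEQ_le_const) auto
    moreover have "fst z = fst z'"
      using fst_eq[of 0] by (simp add: w_def w'_def)
    ultimately show "z = z'"
      by (simp add: prod_eq_iff)
  qed
  thus ?thesis
    unfolding natural_extension_model_def
    using T0_preserving measure_preserving fst_N distr_fst semiconj X inv_meas
    by (auto simp: measure_preserving_map_def)
qed

end
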